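(* Let $p$ be a prime number, let $l\geq 1$ be an integer, and let $n$ be a natural number with $\gcd(n,p)=1$. The monomial dynamical system $\psi_n: x\mapsto x^n$ on $S_{p^{-l}}(1)$ is minimal if and only if it is uniquely ergodic, in which case the unique invariant measure is the Haar measure on $S_{p^{-l}}(1)$.
   Context: $\mathbb{Q}_p$ is the field of $p$-adic numbers with $p$-adic absolute value $|\cdot|_p$ normalized by $|p|_p=p^{-1}$, and $\mathbb{Z}_p$ is the ring of $p$-adic integers. The sphere is $S_{p^{-l}}(1)=\{x\in\mathbb{Q}_p: |x-1|_p=p^{-l}\}$. When $\gcd(n,p)=1$, the map $\psi_n(x)=x^n$ maps $S_{p^{-l}}(1)$ into itself. A continuous map $\psi$ of a compact metric space $X$ into itself is (one-sided) minimal if for every $x\in X$ the orbit $\{\psi^N(x): N\in\mathbb{N}\}$ is dense in $X$, where $\psi^N$ is the $N$-fold iterate. It is uniquely ergodic if there exists exactly one Borel probability measure on $X$ that is invariant under $\psi$. The Haar measure on $S_{p^{-l}}(1)$ means the restriction to $S_{p^{-l}}(1)$ of the (additive) Haar measure of $\mathbb{Z}_p$, normalized to be a probability measure on $S_{p^{-l}}(1)$. *)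

theory Defs
  imports "HOL-Analysis.Analysis" "HOL-Probability.Probability_Measure"
    "HOL-Algebra.QuotRing" "HOL-Computational_Algebra.Primes"
begin

section \<open>The field of p-adic numbers\<close>

definition padic_abs_rat :: "nat \<Rightarrow> rat \<Rightarrow> real" where
  "padic_abs_rat p x =
    (if x = 0 then 0
     else let (a, b) = quotient_of x
          in real p powi (int (multiplicity (int p) b) - int (multiplicity (int p) a)))"

text \<open>The field of p-adic numbers is the completion of the rationals with respect to the p-adic
  absolute value: the ring of p-adic Cauchy sequences modulo the ideal of null sequences.\<close>

definition padic_cauchy :: "nat \<Rightarrow> (nat \<Rightarrow> rat) \<Rightarrow> bool" where
  "padic_cauchy p X \<longleftrightarrow> (\<forall>e>0. \<exists>N. \<forall>i\<ge>N. \<forall>j\<ge>N. padic_abs_rat p (X i - X j) < e)"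

definition padic_cauchy_ring :: "nat \<Rightarrow> (nat \<Rightarrow> rat) ring" where
  "padic_cauchy_ring p =
    \<lparr>carrier = {X. padic_cauchy p X},
     mult = (\<lambda>X Y i. X i * Y i), one = (\<lambda>i. 1), zero = (\<lambda>i. 0), add = (\<lambda>X Y i. X i + Y i)\<rparr>"

definition padic_null_ideal :: "nat \<Rightarrow> (nat \<Rightarrow> rat) set" where
  "padic_null_ideal p = {X. (\<lambda>i. padic_abs_rat p (X i)) \<longlonglongrightarrow> 0}"

definition Qp :: "nat \<Rightarrow> (nat \<Rightarrow> rat) set ring" where
  "Qp p = padic_cauchy_ring p Quot padic_null_ideal p"

text \<open>The absolute values along a representing sequence converge, to a limit that does not depend
  on the representative.\<close>

definition padic_abs :: "nat \<Rightarrow> (nat \<Rightarrow> rat) set \<Rightarrow> real" where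
  "padic_abs p x = (THE r. \<forall>X\<in>x. (\<lambda>i. padic_abs_rat p (X i)) \<longlonglongrightarrow> r)"

text \<open>The locale \<^locale>\<open>Metric_space\<close> wants nonnegativity and symmetry on the whole type, hence
  the value 0 outside the carrier.\<close>

definition padic_dist :: "nat \<Rightarrow> (nat \<Rightarrow> rat) set \<Rightarrow> (nat \<Rightarrow> rat) set \<Rightarrow> real" where
  "padic_dist p x y =
    (if x \<in> carrier (Qp p) \<and> y \<in> carrier (Qp p) then padic_abs p (x \<ominus>\<^bsub>Qp p\<^esub> y) else 0)"

definition padic_topology :: "nat \<Rightarrow> (nat \<Rightarrow> rat) set topology" where
  "padic_topology p = Metric_space.mtopology (carrier (Qp p)) (padic_dist p)"

definition Zp :: "nat \<Rightarrow> (nat \<Rightarrow> rat) set set" where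
  "Zp p = {x \<in> carrier (Qp p). padic_abs p x \<le> 1}"

definition padic_sphere1 :: "nat \<Rightarrow> nat \<Rightarrow> (nat \<Rightarrow> rat) set set" where
  "padic_sphere1 p l =
    {x \<in> carrier (Qp p). padic_abs p (x \<ominus>\<^bsub>Qp p\<^esub> \<one>\<^bsub>Qp p\<^esub>) = 1 / real p ^ l}"

section \<open>Minimality and unique ergodicity\<close>

text \<open>These are meant for a continuous map \<open>f\<close> of the compact metrizable space \<open>T\<close> into itself.\<close>

definition minimal_map :: "'a topology \<Rightarrow> ('a \<Rightarrow> 'a) \<Rightarrow> bool" where
  "minimal_map T f \<longleftrightarrow>
    (\<forall>x\<in>topspace T. T closure_of {(f ^^ N) x | N. N \<in> (UNIV :: nat set)} = topspace T)"

definition borel_sigma_of :: "'a topology \<Rightarrow> 'a measure" where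
  "borel_sigma_of T = sigma (topspace T) {U. openin T U}"

definition invariant_borel_prob :: "'a topology \<Rightarrow> ('a \<Rightarrow> 'a) \<Rightarrow> 'a measure \<Rightarrow> bool" where
  "invariant_borel_prob T f \<mu> \<longleftrightarrow>
    prob_space \<mu> \<and> sets \<mu> = sets (borel_sigma_of T) \<and>
    (\<forall>A\<in>sets \<mu>. emeasure \<mu> (f -` A \<inter> space \<mu>) = emeasure \<mu> A)"

definition uniquely_ergodic :: "'a topology \<Rightarrow> ('a \<Rightarrow> 'a) \<Rightarrow> bool" where
  "uniquely_ergodic T f \<longleftrightarrow> (\<exists>!\<mu>. invariant_borel_prob T f \<mu>)"

section \<open>Haar measure\<close>

definition Zp_haar :: "nat \<Rightarrow> (nat \<Rightarrow> rat) set measure" where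
  "Zp_haar p = (THE \<mu>.
     prob_space \<mu> \<and> sets \<mu> = sets (borel_sigma_of (subtopology (padic_topology p) (Zp p))) \<and>
     (\<forall>a\<in>Zp p. \<forall>A\<in>sets \<mu>. emeasure \<mu> ((\<lambda>x. a \<oplus>\<^bsub>Qp p\<^esub> x) ` A) = emeasure \<mu> A))"

definition sphere_haar :: "nat \<Rightarrow> nat \<Rightarrow> (nat \<Rightarrow> rat) set measure" where
  "sphere_haar p l =
    scale_measure (1 / emeasure (Zp_haar p) (padic_sphere1 p l))
      (restrict_space (Zp_haar p) (padic_sphere1 p l))"

section \<open>The p-adic numbers form a commutative ring and a metric space\<close>

lemma padic_abs_rat_zero [simp]: "padic_abs_rat p 0 = 0"
  by (simp add: padic_abs_rat_def)

lemma padic_abs_rat_quotient: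
  assumes p: "prime p" and "a \<noteq> 0" "b \<noteq> 0"
  shows "padic_abs_rat p (of_int a / of_int b) =
    real p powi (int (multiplicity (int p) b) - int (multiplicity (int p) a))"
proof -
  obtain c d where cd: "quotient_of (of_int a / of_int b :: rat) = (c, d)" by fastforce
  have d: "d > 0" using quotient_of_denom_pos[OF cd] .
  have eq: "(of_int a / of_int b :: rat) = of_int c / of_int d" using quotient_of_div[OF cd] .
  have c: "c \<noteq> 0" using eq assms by auto
  have "(of_int (a * d) :: rat) = of_int (c * b)" using eq d assms by (simp add: field_simps)
  then have e: "a * d = c * b" by (simp only: of_int_eq_iff)
  have pe: "prime_elem (int p)" using p by simp
  have "multiplicity (int p) (a * d) = multiplicity (int p) a + multiplicity (int p) d"
    using prime_elem_multiplicity_mult_distrib[OF pe] assms d by auto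
  moreover have "multiplicity (int p) (c * b) = multiplicity (int p) c + multiplicity (int p) b"
    using prime_elem_multiplicity_mult_distrib[OF pe] assms c by auto
  ultimately have "int (multiplicity (int p) b) - int (multiplicity (int p) a)
     = int (multiplicity (int p) d) - int (multiplicity (int p) c)" using e by simp
  then show ?thesis using cd assms by (simp add: padic_abs_rat_def)
qed

lemma rat_common_denominator:
  fixes x y :: rat
  shows "\<exists>a b m. m \<noteq> 0 \<and> x = of_int a / of_int m \<and> y = of_int b / of_int m"
proof -
  obtain a m where x: "quotient_of x = (a, m)" by fastforce
  obtain b n where y: "quotient_of y = (b, n)" by fastforce
  note f = quotient_of_denom_pos[OF x] quotient_of_denom_pos[OF y] quotient_of_div[OF x] quotient_of_div[OF y]
  have "m * n \<noteq> 0 \<and> x = of_int (a * n) / of_int (m * n) \<and> y = of_int (b * m) / of_int (m * n)"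
    using f by (simp add: field_simps)
  then show ?thesis by blast
qed

lemma padic_abs_rat_nonneg [simp]: "padic_abs_rat p x \<ge> 0"
  by (simp add: padic_abs_rat_def split: prod.split)

lemma padic_abs_rat_mult:
  assumes p: "prime p"
  shows "padic_abs_rat p (x * y) = padic_abs_rat p x * padic_abs_rat p y"
proof (cases "x = 0 \<or> y = 0")
  case False
  obtain a b m where m: "m \<noteq> 0" and x: "x = of_int a / of_int m" and y: "y = of_int b / of_int m"
    using rat_common_denominator[of x y] by blast
  have ab: "a \<noteq> 0" "b \<noteq> 0" using False x y by auto
  have xy: "x * y = of_int (a * b) / of_int (m * m)" by (simp add: x y)
  have pe: "prime_elem (int p)" using p by simp
  have p0: "real p \<noteq> 0" using p by (auto simp: prime_gt_0_nat)
  show ?thesis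
    unfolding xy using p m ab p0
    by (simp only: padic_abs_rat_quotient x y mult_eq_0_iff prime_elem_multiplicity_mult_distrib[OF pe]
         power_int_add[symmetric] simp_thms disj_not1 de_Morgan_disj)
       (simp add: power_int_add[symmetric] algebra_simps)
qed auto

lemma padic_abs_rat_ultra:
  assumes p: "prime p"
  shows "padic_abs_rat p (x + y) \<le> max (padic_abs_rat p x) (padic_abs_rat p y)"
proof (cases "x = 0 \<or> y = 0 \<or> x + y = 0")
  case False
  obtain a b m where m: "m \<noteq> 0" and x: "x = of_int a / of_int m" and y: "y = of_int b / of_int m"
    using rat_common_denominator[of x y] by blast
  have xy: "x + y = of_int (a + b) / of_int m" by (simp add: x y add_divide_distrib)
  have ab: "a \<noteq> 0" "b \<noteq> 0" "a + b \<noteq> 0" using False x y xy by auto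
  let ?v = "multiplicity (int p)"
  have nu: "\<not> is_unit (int p)" using p by auto
  have "int p ^ min (?v a) (?v b) dvd a + b"
    by (intro dvd_add) (auto intro: multiplicity_dvd')
  then have v: "min (?v a) (?v b) \<le> ?v (a + b)"
    using ab nu by (intro multiplicity_geI) auto
  have p1: "real p \<ge> 1" using prime_ge_1_nat[OF p] by simp
  have "?v a \<le> ?v (a + b) \<or> ?v b \<le> ?v (a + b)" using v by linarith
  then have "real p powi (int (?v m) - int (?v (a + b))) \<le> real p powi (int (?v m) - int (?v a)) \<or>
     real p powi (int (?v m) - int (?v (a + b))) \<le> real p powi (int (?v m) - int (?v b))"
    using p1 by (auto intro!: power_int_increasing)
  then show ?thesis
    unfolding xy unfolding x y
    using padic_abs_rat_quotient[OF p ab(1) m] padic_abs_rat_quotient[OF p ab(2) m]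
      padic_abs_rat_quotient[OF p ab(3) m] by (simp add: le_max_iff_disj)
qed (auto simp: le_max_iff_disj)

lemma padic_abs_rat_eq_0_iff [simp]:
  assumes "prime p" shows "padic_abs_rat p x = 0 \<longleftrightarrow> x = 0"
proof -
  have "real p \<noteq> 0" using prime_gt_0_nat[OF assms] by simp
  then show ?thesis by (simp add: padic_abs_rat_def power_int_eq_0_iff split: prod.split)
qed

lemma padic_abs_rat_minus [simp]:
  assumes "prime p" shows "padic_abs_rat p (- x) = padic_abs_rat p x"
proof -
  have "padic_abs_rat p (-1) = 1"
    using padic_abs_rat_quotient[OF assms, of "-1" 1]
    by (simp add: multiplicity_unit_right)
  then show ?thesis using padic_abs_rat_mult[OF assms, of "-1" x] by simp
qed

lemma padic_abs_rat_diff_commute: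
  "prime p \<Longrightarrow> padic_abs_rat p (x - y) = padic_abs_rat p (y - x)"
  using padic_abs_rat_minus[of p "x - y"] by simp

lemma padic_abs_rat_triangle:
  assumes p: "prime p"
  shows "padic_abs_rat p (x + y) \<le> padic_abs_rat p x + padic_abs_rat p y"
  using padic_abs_rat_ultra[OF p, of x y] padic_abs_rat_nonneg[of p x] padic_abs_rat_nonneg[of p y] by linarith

lemma padic_abs_rat_reverse_triangle:
  assumes p: "prime p"
  shows "\<bar>padic_abs_rat p x - padic_abs_rat p y\<bar> \<le> padic_abs_rat p (x - y)"
  using padic_abs_rat_triangle[OF p, of "x - y" y] padic_abs_rat_triangle[OF p, of "y - x" x]
    padic_abs_rat_diff_commute[OF p, of x y] by simp

lemma padic_abs_rat_convergent:
  assumes p: "prime p" and X: "padic_cauchy p X"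
  shows "convergent (\<lambda>i. padic_abs_rat p (X i))"
proof (rule Cauchy_convergent, rule metric_CauchyI)
  fix e :: real assume "e > 0"
  then obtain N where "\<forall>i\<ge>N. \<forall>j\<ge>N. padic_abs_rat p (X i - X j) < e"
    using X unfolding padic_cauchy_def by meson
  then show "\<exists>M. \<forall>m\<ge>M. \<forall>n\<ge>M. dist (padic_abs_rat p (X m)) (padic_abs_rat p (X n)) < e"
    using padic_abs_rat_reverse_triangle[OF p] by (metis dist_real_def order_le_less_trans)
qed

lemma padic_cauchy_add:
  assumes p: "prime p" and X: "padic_cauchy p X" and Y: "padic_cauchy p Y"
  shows "padic_cauchy p (\<lambda>i. X i + Y i)"
  unfolding padic_cauchy_def
proof (intro allI impI)
  fix e :: real assume e: "e > 0"
  obtain M where M: "\<forall>i\<ge>M. \<forall>j\<ge>M. padic_abs_rat p (X i - X j) < e"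
    using X e unfolding padic_cauchy_def by meson
  obtain N where N: "\<forall>i\<ge>N. \<forall>j\<ge>N. padic_abs_rat p (Y i - Y j) < e"
    using Y e unfolding padic_cauchy_def by meson
  have "padic_abs_rat p (X i + Y i - (X j + Y j)) < e" if "i \<ge> max M N" "j \<ge> max M N" for i j
  proof -
    have "padic_abs_rat p (X i - X j) < e" "padic_abs_rat p (Y i - Y j) < e" using M N that by auto
    then show ?thesis
      using padic_abs_rat_ultra[OF p, of "X i - X j" "Y i - Y j"] by (simp add: add_diff_add)
  qed
  then show "\<exists>N. \<forall>i\<ge>N. \<forall>j\<ge>N. padic_abs_rat p (X i + Y i - (X j + Y j)) < e" by blast
qed

lemma padic_cauchy_bounded:
  assumes p: "prime p" and X: "padic_cauchy p X"
  obtains B where "B > 0" "\<And>i. padic_abs_rat p (X i) \<le> B"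
proof -
  have "Bseq (\<lambda>i. padic_abs_rat p (X i))"
    using padic_abs_rat_convergent[OF p X] by (rule convergent_imp_Bseq)
  then show ?thesis using that by (metis BseqE abs_of_nonneg padic_abs_rat_nonneg real_norm_def)
qed

lemma padic_cauchy_mult:
  assumes p: "prime p" and X: "padic_cauchy p X" and Y: "padic_cauchy p Y"
  shows "padic_cauchy p (\<lambda>i. X i * Y i)"
  unfolding padic_cauchy_def
proof (intro allI impI)
  fix e :: real assume e: "e > 0"
  obtain A where A: "A > 0" "\<And>i. padic_abs_rat p (X i) \<le> A" using padic_cauchy_bounded[OF p X] by blast
  obtain B where B: "B > 0" "\<And>i. padic_abs_rat p (Y i) \<le> B" using padic_cauchy_bounded[OF p Y] by blast
  obtain M where M: "\<forall>i\<ge>M. \<forall>j\<ge>M. padic_abs_rat p (X i - X j) < e / B"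
    using X e B unfolding padic_cauchy_def by (meson divide_pos_pos)
  obtain N where N: "\<forall>i\<ge>N. \<forall>j\<ge>N. padic_abs_rat p (Y i - Y j) < e / A"
    using Y e A unfolding padic_cauchy_def by (meson divide_pos_pos)
  have "padic_abs_rat p (X i * Y i - X j * Y j) < e" if "i \<ge> max M N" "j \<ge> max M N" for i j
  proof -
    have eq: "X i * Y i - X j * Y j = (X i - X j) * Y i + X j * (Y i - Y j)" by (simp add: algebra_simps)
    have "padic_abs_rat p (X i - X j) * padic_abs_rat p (Y i) \<le> padic_abs_rat p (X i - X j) * B"
      by (intro mult_left_mono B) auto
    also have "\<dots> < e" using M that B by (simp add: field_simps)
    finally have 1: "padic_abs_rat p ((X i - X j) * Y i) < e" by (simp add: padic_abs_rat_mult[OF p])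
    have "padic_abs_rat p (X j) * padic_abs_rat p (Y i - Y j) \<le> A * padic_abs_rat p (Y i - Y j)"
      by (intro mult_right_mono A) auto
    also have "\<dots> < e" using N that A by (simp add: field_simps)
    finally have 2: "padic_abs_rat p (X j * (Y i - Y j)) < e" by (simp add: padic_abs_rat_mult[OF p])
    show ?thesis unfolding eq
      using 1 2 padic_abs_rat_ultra[OF p, of "(X i - X j) * Y i" "X j * (Y i - Y j)"] by linarith
  qed
  then show "\<exists>N. \<forall>i\<ge>N. \<forall>j\<ge>N. padic_abs_rat p (X i * Y i - X j * Y j) < e" by blast
qed

lemma padic_cauchy_const: "padic_cauchy p (\<lambda>i. c)"
  by (auto simp: padic_cauchy_def)

lemma padic_cauchy_uminus:
  assumes "prime p" "padic_cauchy p X" shows "padic_cauchy p (\<lambda>i. - X i)"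
  using padic_cauchy_mult[OF assms(1) padic_cauchy_const[of p "-1"] assms(2)] by simp

lemma cring_padic_cauchy_ring:
  assumes p: "prime p" shows "cring (padic_cauchy_ring p)"
proof (rule cringI)
  show "abelian_group (padic_cauchy_ring p)"
  proof (rule abelian_groupI)
    fix X assume "X \<in> carrier (padic_cauchy_ring p)"
    then show "\<exists>Y\<in>carrier (padic_cauchy_ring p).
        Y \<oplus>\<^bsub>padic_cauchy_ring p\<^esub> X = \<zero>\<^bsub>padic_cauchy_ring p\<^esub>"
      using padic_cauchy_uminus[OF p, of X]
      by (intro bexI[of _ "\<lambda>i. - X i"]) (auto simp: padic_cauchy_ring_def)
  qed (simp_all add: padic_cauchy_ring_def add_ac padic_cauchy_const padic_cauchy_add[OF p])
  show "Group.comm_monoid (padic_cauchy_ring p)"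
    by (rule comm_monoidI)
      (simp_all add: padic_cauchy_ring_def mult_ac padic_cauchy_const padic_cauchy_mult[OF p])
qed (simp add: padic_cauchy_ring_def distrib_right)

lemma padic_null_imp_cauchy:
  assumes p: "prime p" and X: "X \<in> padic_null_ideal p"
  shows "padic_cauchy p X"
  unfolding padic_cauchy_def
proof (intro allI impI)
  fix e :: real assume e: "e > 0"
  obtain N where N: "\<And>i. i \<ge> N \<Longrightarrow> padic_abs_rat p (X i) < e"
    using X e unfolding padic_null_ideal_def LIMSEQ_def by (auto simp: dist_real_def)
  have "padic_abs_rat p (X i - X j) < e" if "i \<ge> N" "j \<ge> N" for i j
    using padic_abs_rat_ultra[OF p, of "X i" "- X j"] N[OF that(1)] N[OF that(2)] p by simp
  then show "\<exists>N. \<forall>i\<ge>N. \<forall>j\<ge>N. padic_abs_rat p (X i - X j) < e" by blast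
qed

lemma padic_null_add:
  assumes p: "prime p" and "X \<in> padic_null_ideal p" "Y \<in> padic_null_ideal p"
  shows "(\<lambda>i. X i + Y i) \<in> padic_null_ideal p"
proof -
  have "(\<lambda>i. padic_abs_rat p (X i) + padic_abs_rat p (Y i)) \<longlonglongrightarrow> 0"
    using assms by (intro tendsto_add_zero) (simp_all add: padic_null_ideal_def)
  then show ?thesis unfolding padic_null_ideal_def mem_Collect_eq
    by (rule Lim_null_comparison[rotated]) (simp add: padic_abs_rat_triangle[OF p])
qed

lemma padic_null_mult:
  assumes p: "prime p" and X: "padic_cauchy p X" and Y: "Y \<in> padic_null_ideal p"
  shows "(\<lambda>i. X i * Y i) \<in> padic_null_ideal p"
proof -
  obtain L where "(\<lambda>i. padic_abs_rat p (X i)) \<longlonglongrightarrow> L"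
    using padic_abs_rat_convergent[OF p X] by (auto simp: convergent_def)
  then show ?thesis using Y tendsto_mult[of "\<lambda>i. padic_abs_rat p (X i)" L sequentially]
    unfolding padic_null_ideal_def by (fastforce simp: padic_abs_rat_mult[OF p])
qed

lemma ideal_padic_null_ideal:
  assumes p: "prime p" shows "ideal (padic_null_ideal p) (padic_cauchy_ring p)"
proof -
  interpret R: cring "padic_cauchy_ring p" by (rule cring_padic_cauchy_ring[OF p])
  have um: "\<ominus>\<^bsub>padic_cauchy_ring p\<^esub> X = (\<lambda>i. - X i)" if "X \<in> carrier (padic_cauchy_ring p)" for X
    using that padic_cauchy_uminus[OF p, of X]
    by (intro R.minus_equality) (auto simp: padic_cauchy_ring_def)
  show ?thesis
  proof (rule idealI[OF R.ring_axioms])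
    show "subgroup (padic_null_ideal p) (add_monoid (padic_cauchy_ring p))"
    proof (rule group.subgroupI[OF R.a_group])
      show "padic_null_ideal p \<noteq> {}"
        by (auto simp: padic_null_ideal_def intro!: exI[of _ "\<lambda>_. 0"])
    next
      fix X assume X: "X \<in> padic_null_ideal p"
      have "inv\<^bsub>add_monoid (padic_cauchy_ring p)\<^esub> X = (\<lambda>i. - X i)"
        using um[of X] padic_null_imp_cauchy[OF p X] by (simp add: a_inv_def padic_cauchy_ring_def)
      then show "inv\<^bsub>add_monoid (padic_cauchy_ring p)\<^esub> X \<in> padic_null_ideal p"
        using X p by (simp add: padic_null_ideal_def)
    qed (auto simp: padic_cauchy_ring_def padic_null_imp_cauchy[OF p] padic_null_add[OF p])
  next
    fix X Y assume "X \<in> padic_null_ideal p" "Y \<in> carrier (padic_cauchy_ring p)"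
    then have "(\<lambda>i. Y i * X i) \<in> padic_null_ideal p"
      using padic_null_mult[OF p, of Y X] by (simp add: padic_cauchy_ring_def)
    then show "Y \<otimes>\<^bsub>padic_cauchy_ring p\<^esub> X \<in> padic_null_ideal p"
      "X \<otimes>\<^bsub>padic_cauchy_ring p\<^esub> Y \<in> padic_null_ideal p"
      by (simp_all add: padic_cauchy_ring_def mult.commute)
  qed
qed

definition padic_class :: "nat \<Rightarrow> (nat \<Rightarrow> rat) \<Rightarrow> (nat \<Rightarrow> rat) set" where
  "padic_class p X = padic_null_ideal p +>\<^bsub>padic_cauchy_ring p\<^esub> X"

lemma padic_class_mem:
  "Y \<in> padic_class p X \<longleftrightarrow> (\<lambda>i. Y i - X i) \<in> padic_null_ideal p"
proof -
  have "\<exists>h\<in>padic_null_ideal p. Y = (\<lambda>i. h i + X i)" if "(\<lambda>i. Y i - X i) \<in> padic_null_ideal p"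
    by (rule bexI[OF _ that]) auto
  then show ?thesis
    by (auto simp: padic_class_def a_r_coset_def r_coset_def padic_cauchy_ring_def)
qed

lemma carrier_Qp: "carrier (Qp p) = padic_class p ` {X. padic_cauchy p X}"
  by (auto simp: Qp_def FactRing_def A_RCOSETS_def RCOSETS_def a_r_coset_def padic_class_def
      padic_cauchy_ring_def)

lemma cring_Qp:
  assumes p: "prime p" shows "cring (Qp p)"
  unfolding Qp_def
  using ideal.quotient_is_cring[OF ideal_padic_null_ideal[OF p] cring_padic_cauchy_ring[OF p]] .

lemma padic_class_hom:
  assumes p: "prime p" shows "padic_class p \<in> ring_hom (padic_cauchy_ring p) (Qp p)"
  using ideal.rcos_ring_hom[OF ideal_padic_null_ideal[OF p]]
  by (simp add: Qp_def padic_class_def[abs_def])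

lemma padic_class_minus:
  assumes p: "prime p" and "padic_cauchy p X" "padic_cauchy p Y"
  shows "padic_class p X \<ominus>\<^bsub>Qp p\<^esub> padic_class p Y = padic_class p (\<lambda>i. X i - Y i)"
proof -
  interpret Q: cring "Qp p" by (rule cring_Qp[OF p])
  note h = ring_hom_add[OF padic_class_hom[OF p]]
  have c: "padic_class p Z \<in> carrier (Qp p)" if "padic_cauchy p Z" for Z
    using that by (auto simp: carrier_Qp)
  have XY: "padic_cauchy p (\<lambda>i. X i - Y i)"
    using padic_cauchy_add[OF p assms(2) padic_cauchy_uminus[OF p assms(3)]] by simp
  have "padic_class p (\<lambda>i. X i - Y i) \<oplus>\<^bsub>Qp p\<^esub> padic_class p Y = padic_class p X"
    using h[of "\<lambda>i. X i - Y i" Y] XY assms by (simp add: padic_cauchy_ring_def)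
  then have "padic_class p X \<ominus>\<^bsub>Qp p\<^esub> padic_class p Y =
      (padic_class p (\<lambda>i. X i - Y i) \<oplus>\<^bsub>Qp p\<^esub> padic_class p Y) \<ominus>\<^bsub>Qp p\<^esub> padic_class p Y"
    by simp
  also have "\<dots> = padic_class p (\<lambda>i. X i - Y i)"
    using c[OF XY] c[OF assms(3)] by (simp add: Q.minus_eq Q.a_assoc Q.r_neg)
  finally show ?thesis .
qed

lemma padic_abs_class:
  assumes p: "prime p" and X: "padic_cauchy p X"
  shows "(\<lambda>i. padic_abs_rat p (X i)) \<longlonglongrightarrow> padic_abs p (padic_class p X)"
proof -
  obtain r where r: "(\<lambda>i. padic_abs_rat p (X i)) \<longlonglongrightarrow> r"
    using padic_abs_rat_convergent[OF p X] by (auto simp: convergent_def)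
  have all: "(\<lambda>i. padic_abs_rat p (Y i)) \<longlonglongrightarrow> r" if "Y \<in> padic_class p X" for Y
  proof -
    have 0: "(\<lambda>i. padic_abs_rat p (Y i - X i)) \<longlonglongrightarrow> 0"
      using that by (simp add: padic_class_mem padic_null_ideal_def)
    have "(\<lambda>i. padic_abs_rat p (Y i) - padic_abs_rat p (X i)) \<longlonglongrightarrow> 0"
      by (rule Lim_null_comparison[OF _ 0]) (simp add: padic_abs_rat_reverse_triangle[OF p])
    from tendsto_add[OF this r] show ?thesis by simp
  qed
  have self: "X \<in> padic_class p X" by (simp add: padic_class_mem padic_null_ideal_def)
  have "padic_abs p (padic_class p X) = r"
    unfolding padic_abs_def using all self r by (intro the_equality) (auto intro: LIMSEQ_unique)
  then show ?thesis using r by simp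
qed

lemma padic_class_eq_iff:
  assumes p: "prime p" and "padic_cauchy p X" "padic_cauchy p Y"
  shows "padic_class p X = padic_class p Y \<longleftrightarrow> (\<lambda>i. X i - Y i) \<in> padic_null_ideal p"
proof
  assume "padic_class p X = padic_class p Y"
  moreover have "X \<in> padic_class p X" by (simp add: padic_class_mem padic_null_ideal_def)
  ultimately show "(\<lambda>i. X i - Y i) \<in> padic_null_ideal p" by (simp add: padic_class_mem)
next
  assume a: "(\<lambda>i. X i - Y i) \<in> padic_null_ideal p"
  then have b: "(\<lambda>i. Y i - X i) \<in> padic_null_ideal p"
    by (simp add: padic_null_ideal_def padic_abs_rat_diff_commute[OF p])
  show "padic_class p X = padic_class p Y"
  proof (intro equalityI subsetI)
    fix Z assume "Z \<in> padic_class p X"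
    then show "Z \<in> padic_class p Y"
      using padic_null_add[OF p _ a, of "\<lambda>i. Z i - X i"] by (simp add: padic_class_mem)
  next
    fix Z assume "Z \<in> padic_class p Y"
    then show "Z \<in> padic_class p X"
      using padic_null_add[OF p _ b, of "\<lambda>i. Z i - Y i"] by (simp add: padic_class_mem)
  qed
qed

lemma padic_dist_class:
  assumes p: "prime p" and "padic_cauchy p X" "padic_cauchy p Y"
  shows "(\<lambda>i. padic_abs_rat p (X i - Y i)) \<longlonglongrightarrow> padic_dist p (padic_class p X) (padic_class p Y)"
proof -
  have XY: "padic_cauchy p (\<lambda>i. X i - Y i)"
    using padic_cauchy_add[OF p assms(2) padic_cauchy_uminus[OF p assms(3)]] by simp
  show ?thesis
    using padic_abs_class[OF p XY] assms
    by (auto simp: padic_dist_def carrier_Qp padic_class_minus[OF p])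
qed

lemma Metric_space_Qp:
  assumes p: "prime p" shows "Metric_space (carrier (Qp p)) (padic_dist p)"
proof
  have D: "\<exists>X Y. padic_cauchy p X \<and> padic_cauchy p Y \<and> x = padic_class p X \<and> y = padic_class p Y"
    if "x \<in> carrier (Qp p)" "y \<in> carrier (Qp p)" for x y using that by (auto simp: carrier_Qp)
  show "0 \<le> padic_dist p x y" for x y
  proof (cases "x \<in> carrier (Qp p) \<and> y \<in> carrier (Qp p)")
    case True
    then obtain X Y where "padic_cauchy p X" "padic_cauchy p Y" "x = padic_class p X" "y = padic_class p Y"
      using D by blast
    then show ?thesis using LIMSEQ_le_const[OF padic_dist_class[OF p, of X Y], of 0] by auto
  qed (auto simp: padic_dist_def)
  show "padic_dist p x y = padic_dist p y x" for x y
  proof (cases "x \<in> carrier (Qp p) \<and> y \<in> carrier (Qp p)")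
    case True
    then obtain X Y where "padic_cauchy p X" "padic_cauchy p Y" "x = padic_class p X" "y = padic_class p Y"
      using D by blast
    then show ?thesis using padic_dist_class[OF p, of X Y] padic_dist_class[OF p, of Y X]
      by (auto simp: padic_abs_rat_diff_commute[OF p] intro: LIMSEQ_unique)
  qed (auto simp: padic_dist_def)
  show "padic_dist p x y = 0 \<longleftrightarrow> x = y" if xy: "x \<in> carrier (Qp p)" "y \<in> carrier (Qp p)" for x y
  proof -
    obtain X Y where *: "padic_cauchy p X" "padic_cauchy p Y" "x = padic_class p X" "y = padic_class p Y"
      using D[OF xy] by blast
    show ?thesis using padic_dist_class[OF p *(1,2)] padic_class_eq_iff[OF p *(1,2)] *(3,4)
      by (auto simp: padic_null_ideal_def intro: LIMSEQ_unique)
  qed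
  show "padic_dist p x z \<le> padic_dist p x y + padic_dist p y z"
    if xyz: "x \<in> carrier (Qp p)" "y \<in> carrier (Qp p)" "z \<in> carrier (Qp p)" for x y z
  proof -
    obtain X Y where *: "padic_cauchy p X" "padic_cauchy p Y" "x = padic_class p X" "y = padic_class p Y"
      using D[OF xyz(1,2)] by blast
    obtain Z where Z: "padic_cauchy p Z" "z = padic_class p Z" using xyz(3) by (auto simp: carrier_Qp)
    show ?thesis unfolding * Z
      by (rule LIMSEQ_le[OF padic_dist_class[OF p *(1) Z(1)]
            tendsto_add[OF padic_dist_class[OF p *(1,2)] padic_dist_class[OF p *(2) Z(1)]]])
         (metis padic_abs_rat_triangle[OF p] diff_add_cancel add_diff_eq)
  qed
qed

end

theory Submission
  imports Defs "HOL-Probability.Infinite_Product_Measure"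
begin

text \<open>On the sphere the power map is an isometry: \<open>x ^ n - y ^ n\<close> is \<open>x - y\<close> times a sum of \<open>n\<close>
  terms congruent to 1 modulo \<open>p\<close>, and such a sum is a unit because \<open>p\<close> does not divide \<open>n\<close>
  (\<open>padic_abs_rat_power_diff\<close>, \<open>power_isometry\<close>). Everything else is a fact about isometries \<open>f\<close> of a totally
  bounded ultrametric space that carries an equidistributed measure \<open>\<mu>\<close>, a Borel probability measure which
  gives the same mass to all balls of the same radius. For fixed radius these balls are finitely
  many disjoint cells, so equidistribution determines the mass of every cell, and with it the
  measure (\<open>equidistributed_unique\<close>).

  An isometry permutes the cells of each radius, hence it preserves \<open>\<mu>\<close>
  (\<open>isometry_preserves_equidistributed\<close>); so \<open>\<mu>\<close> is the only candidate for a unique invariant measure.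
  If \<open>f\<close> is minimal, the orbit of any cell visits every other one, all cells of a radius have the same mass under
  any invariant measure, and this measure is \<open>\<mu>\<close>
  (\<open>minimal_isometry_invariant_equidistributed\<close>). If \<open>f\<close> is not minimal, some orbit misses a cell, and \<open>\<mu>\<close>
  conditioned on the union of the cells which the orbit visits is an invariant measure
  different from \<open>\<mu>\<close> (\<open>uniquely_ergodic_isometry_minimal\<close>).

  Finally, Haar measure on the p-adic integers is the equidistributed measure. It exists as the distribution
  of a p-adic expansion with independent uniform digits, and equidistribution is the same as
  translation invariance: translations are isometries, and they act transitively on the cells
  of each radius (\<open>equidistributed_iff_translation_invariant\<close>). Its restriction to the sphere, a union of cells,
  is equidistributed again (\<open>sphere_haar_equidistributed\<close>).\<close>

section \<open>Equidistributed measures on totally bounded ultrametric spaces\<close>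

lemma space_borel_sigma_of [simp]: "space (borel_sigma_of T) = topspace T"
  by (simp add: borel_sigma_of_def space_measure_of_conv)

lemma sets_borel_sigma_of: "sets (borel_sigma_of T) = sigma_sets (topspace T) {U. openin T U}"
  unfolding borel_sigma_of_def by (rule sets_measure_of) (auto dest: openin_subset)

lemma openin_in_borel_sigma_of: "openin T U \<Longrightarrow> U \<in> sets (borel_sigma_of T)"
  by (auto simp: sets_borel_sigma_of)

lemma closedin_in_borel_sigma_of:
  assumes "closedin T C" shows "C \<in> sets (borel_sigma_of T)"
proof -
  have "topspace T - (topspace T - C) \<in> sets (borel_sigma_of T)"
    using assms by (metis closedin_def openin_in_borel_sigma_of sets.compl_sets space_borel_sigma_of)
  moreover have "topspace T - (topspace T - C) = C" using closedin_subset[OF assms] by blast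
  ultimately show ?thesis by simp
qed

lemma sets_borel_sigma_of_subtopology:
  assumes "S \<in> sets (borel_sigma_of T)"
  shows "sets (borel_sigma_of (subtopology T S)) = sets (restrict_space (borel_sigma_of T) S)"
proof -
  have sub: "S \<subseteq> topspace T" using sets.sets_into_space[OF assms] by simp
  have "{U. openin (subtopology T S) U} = (\<inter>) S ` {U. openin T U}"
    by (auto simp: openin_subtopology Int_commute)
  then show ?thesis
    using sub assms sigma_sets_Int[of S "topspace T" "{U. openin T U}"]
    by (simp add: sets_restrict_space sets_borel_sigma_of topspace_subtopology Int_absorb1)
qed

text \<open>Total boundedness is only asked for along one sequence of radii tending to 0, and closed balls
  of exactly these radii serve as the cells of all counting arguments. In the applications the
  radii are powers of \<open>1/p\<close>, so the cells are the residue classes modulo powers of \<open>p\<close>.\<close>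

locale totally_bounded_ultrametric = Metric_space M d for M :: "'a set" and d +
  fixes \<rho> :: "nat \<Rightarrow> real"
  assumes ultrametric: "\<lbrakk>x \<in> M; y \<in> M; z \<in> M\<rbrakk> \<Longrightarrow> d x z \<le> max (d x y) (d y z)"
    and radius_pos: "\<rho> k > 0"
    and radius_null: "\<rho> \<longlonglongrightarrow> 0"
    and finite_cells: "finite ((\<lambda>x. mcball x (\<rho> k)) ` M)"
begin

definition cells :: "nat \<Rightarrow> 'a set set" where
  "cells k = (\<lambda>x. mcball x (\<rho> k)) ` M"

definition equidistributed :: "'a measure \<Rightarrow> bool" where
  "equidistributed \<nu> \<longleftrightarrow> prob_space \<nu> \<and> sets \<nu> = sets (borel_sigma_of mtopology) \<and>
     (\<forall>k. \<forall>x\<in>M. \<forall>y\<in>M. measure \<nu> (mcball x (\<rho> k)) = measure \<nu> (mcball y (\<rho> k)))"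

definition isometry :: "('a \<Rightarrow> 'a) \<Rightarrow> bool" where
  "isometry f \<longleftrightarrow> f \<in> M \<rightarrow> M \<and> (\<forall>x\<in>M. \<forall>y\<in>M. d (f x) (f y) = d x y)"

lemma radius_nonneg [simp]: "0 \<le> \<rho> k"
  using radius_pos[of k] by simp

lemma small_radius:
  assumes "e > 0" obtains k where "\<rho> k < e"
  using order_tendstoD(2)[OF radius_null assms] by (auto simp: eventually_sequentially)

lemma mcball_recentre:
  assumes "y \<in> mcball x r" shows "mcball y r = mcball x r"
proof -
  have "z \<in> mcball y r \<longleftrightarrow> z \<in> mcball x r" for z
    using assms ultrametric[of y x z] ultrametric[of x y z] commute[of x y] by auto
  then show ?thesis by blast
qed

lemma mcball_nested:
  assumes "r \<le> s" "mcball x r \<inter> mcball y s \<noteq> {}" shows "mcball x r \<subseteq> mcball y s"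
proof -
  obtain z where z: "z \<in> mcball x r" "z \<in> mcball y s" using assms(2) by blast
  show ?thesis
    using mcball_recentre[OF z(1)] mcball_recentre[OF z(2)] mcball_subset_concentric[OF assms(1), of z]
    by simp
qed

lemma cell_in_borel [measurable]: "mcball x r \<in> sets (borel_sigma_of mtopology)"
  by (rule closedin_in_borel_sigma_of) simp

lemma finite_cells' [simp]: "finite (cells k)"
  using finite_cells by (simp add: cells_def)

lemma Union_cells: "\<Union> (cells k) = M"
proof
  show "M \<subseteq> \<Union> (cells k)" using radius_nonneg by (force simp: cells_def)
qed (auto simp: cells_def)

lemma disjoint_cells: "disjoint (cells k)"
proof (rule disjointI)
  fix A B assume AB: "A \<in> cells k" "B \<in> cells k" "A \<noteq> B"
  then obtain x y where xy: "A = mcball x (\<rho> k)" "B = mcball y (\<rho> k)" by (auto simp: cells_def)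
  then show "A \<inter> B = {}"
    using AB(3) mcball_nested[of "\<rho> k" "\<rho> k" x y] mcball_nested[of "\<rho> k" "\<rho> k" y x] by blast
qed

text \<open>Every open set is the union of the cells that it contains, and there are only countably many
  cells in total.\<close>

lemma borel_eq_sigma_cells:
  "sets (borel_sigma_of mtopology) = sigma_sets M (insert {} (\<Union>k. cells k))"
proof (rule antisym)
  let ?C = "insert {} (\<Union>k. cells k)"
  have C: "?C \<subseteq> Pow M" using mcball_subset_mspace by (auto simp: cells_def)
  have "countable (\<Union>k. cells k)" by (intro countable_UN) (auto intro: countable_finite)
  show "sets (borel_sigma_of mtopology) \<subseteq> sigma_sets M ?C"
    unfolding sets_borel_sigma_of topspace_mtopology
  proof (rule sigma_sets_mono, safe)
    fix U assume U: "openin mtopology U"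
    let ?F = "{B \<in> (\<Union>k. cells k). B \<subseteq> U}"
    have "x \<in> \<Union>?F" if x: "x \<in> U" for x
    proof -
      obtain e where e: "e > 0" "mball x e \<subseteq> U" using U x by (auto simp: openin_mtopology)
      obtain k where "\<rho> k < e" using small_radius[OF e(1)] by blast
      then have "mcball x (\<rho> k) \<subseteq> U" using e(2) mcball_subset_mball_concentric by blast
      moreover have "x \<in> M" using openin_subset[OF U] x by auto
      ultimately have "mcball x (\<rho> k) \<in> ?F" "x \<in> mcball x (\<rho> k)" by (auto simp: cells_def)
      then show ?thesis by blast
    qed
    then have "U = \<Union>?F" by blast
    moreover have "countable ?F" using \<open>countable (\<Union>k. cells k)\<close> by (rule countable_subset[rotated]) blast
    moreover have "\<Union>?F \<in> sigma_sets M ?C"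
      by (rule sigma_algebra.countable_Union[OF sigma_algebra_sigma_sets[OF C] \<open>countable ?F\<close>]) blast
    ultimately show "U \<in> sigma_sets M ?C" by simp
  qed
  have "?C \<subseteq> sets (borel_sigma_of mtopology)" by (auto simp: cells_def)
  then show "sigma_sets M ?C \<subseteq> sets (borel_sigma_of mtopology)"
    using sets.sigma_sets_subset[of ?C "borel_sigma_of mtopology"] by simp
qed

lemma Int_stable_cells: "Int_stable (insert {} (\<Union>k. cells k))"
proof (rule Int_stableI)
  fix A B assume AB: "A \<in> insert {} (\<Union>k. cells k)" "B \<in> insert {} (\<Union>k. cells k)"
  show "A \<inter> B \<in> insert {} (\<Union>k. cells k)"
  proof (cases "A \<inter> B = {}")
    case False
    then obtain x y j k where xy: "A = mcball x (\<rho> j)" "B = mcball y (\<rho> k)"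
      using AB by (auto simp: cells_def)
    have "A \<subseteq> B \<or> B \<subseteq> A"
      using False xy mcball_nested[of "\<rho> j" "\<rho> k" x y] mcball_nested[of "\<rho> k" "\<rho> j" y x]
      by (metis Int_commute linear)
    then have "A \<inter> B = A \<or> A \<inter> B = B" by blast
    then show ?thesis using AB by metis
  qed simp
qed

lemma equidistributed_cell_mass:
  assumes \<nu>: "equidistributed \<nu>" and x: "x \<in> M"
  shows "measure \<nu> (mcball x (\<rho> k)) = 1 / real (card (cells k))"
proof -
  interpret prob_space \<nu> using \<nu> by (simp add: equidistributed_def)
  have sets: "sets \<nu> = sets (borel_sigma_of mtopology)" using \<nu> by (simp add: equidistributed_def)
  have space: "space \<nu> = M" using sets_eq_imp_space_eq[OF sets] by simp
  have "1 = measure \<nu> (\<Union>B\<in>cells k. B)" using prob_space space Union_cells[of k] by simp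
  also have "\<dots> = (\<Sum>B\<in>cells k. measure \<nu> B)"
    using disjoint_cells[of k] by (intro finite_measure_finite_Union finite_cells')
       (auto simp: sets cells_def disjoint_family_on_def disjoint_def)
  also have "\<dots> = (\<Sum>B\<in>cells k. measure \<nu> (mcball x (\<rho> k)))"
  proof (rule sum.cong)
    fix B assume "B \<in> cells k"
    then obtain y where "y \<in> M" "B = mcball y (\<rho> k)" by (auto simp: cells_def)
    then show "measure \<nu> B = measure \<nu> (mcball x (\<rho> k))"
      using \<nu> x unfolding equidistributed_def by blast
  qed simp
  finally have "real (card (cells k)) * measure \<nu> (mcball x (\<rho> k)) = 1" by simp
  then show ?thesis by (metis mult_zero_left nonzero_divide_eq_eq mult.commute zero_neq_one)
qed

lemma equidistributed_cell_pos:
  assumes "equidistributed \<nu>" "x \<in> M" shows "measure \<nu> (mcball x (\<rho> k)) > 0"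
proof -
  have "card (cells k) > 0" using assms(2) by (metis card_gt_0_iff cells_def empty_iff finite_cells' image_is_empty)
  then show ?thesis using equidistributed_cell_mass[OF assms] by simp
qed

text \<open>The cells form an intersection stable generator of the Borel sets, and equidistribution
  prescribes the mass of each of them.\<close>

lemma equidistributed_unique:
  assumes \<mu>: "equidistributed \<mu>" and \<nu>: "equidistributed \<nu>"
  shows "\<mu> = \<nu>"
proof (rule measure_eqI_generator_eq_countable[OF Int_stable_cells, of M])
  interpret \<mu>: prob_space \<mu> using \<mu> by (simp add: equidistributed_def)
  interpret \<nu>: prob_space \<nu> using \<nu> by (simp add: equidistributed_def)
  show "insert {} (\<Union>k. cells k) \<subseteq> Pow M" using mcball_subset_mspace by (auto simp: cells_def)
  show "emeasure \<mu> X = emeasure \<nu> X" if "X \<in> insert {} (\<Union>k. cells k)" for X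
    using that equidistributed_cell_mass[OF \<mu>] equidistributed_cell_mass[OF \<nu>]
    by (auto simp: cells_def \<mu>.emeasure_eq_measure \<nu>.emeasure_eq_measure)
  show "sets \<mu> = sigma_sets M (insert {} (\<Union>k. cells k))"
    "sets \<nu> = sigma_sets M (insert {} (\<Union>k. cells k))"
    using \<mu> \<nu> by (simp_all add: equidistributed_def borel_eq_sigma_cells)
  show "cells 0 \<subseteq> insert {} (\<Union>k. cells k)" "\<Union> (cells 0) = M" "countable (cells 0)"
    using Union_cells by (auto intro: countable_finite)
qed (use \<mu> in \<open>simp add: equidistributed_def prob_space_def finite_measure.emeasure_finite\<close>)

section \<open>Isometries of totally bounded ultrametric spaces\<close>

lemma isometry_funpow:
  assumes "isometry f" shows "isometry (f ^^ N)"
proof (induction N)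
  case (Suc N)
  then show ?case using assms by (auto simp: isometry_def Pi_iff)
qed (simp add: isometry_def)

text \<open>Orbits are recurrent: two points of the orbit of \<open>y\<close> share a cell by the pigeonhole principle,
  and as the map preserves distances, they can be pulled back along it until the
  earlier one is \<open>y\<close> itself. This makes the map surjective up to the scale of a cell.\<close>

lemma isometry_cell_preimage:
  assumes f: "isometry f" and y: "y \<in> M"
  obtains x where "x \<in> M" "f -` mcball y (\<rho> k) \<inter> M = mcball x (\<rho> k)"
proof -
  let ?c = "\<lambda>N. mcball ((f ^^ N) y) (\<rho> k)"
  have in_M: "(f ^^ N) y \<in> M" for N using isometry_funpow[OF f, of N] y by (auto simp: isometry_def)
  have "range ?c \<subseteq> cells k" using in_M by (auto simp: cells_def)
  then have "finite (range ?c)" by (rule finite_subset) simp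
  then have "\<not> inj ?c" using finite_imageD by blast
  then obtain i j where ij: "i < j" "?c i = ?c j" unfolding inj_def by (metis nat_neq_iff)
  define t where "t = j - Suc i"
  have j: "j = i + Suc t" using ij(1) by (simp add: t_def)
  have "(f ^^ j) y \<in> ?c i" using ij(2) in_M by (metis centre_in_mcball_iff radius_nonneg)
  then have "d ((f ^^ i) y) ((f ^^ i) ((f ^^ Suc t) y)) \<le> \<rho> k"
    by (simp only: j funpow_add o_apply in_mcball)
  then have "d y ((f ^^ Suc t) y) \<le> \<rho> k"
    using isometry_funpow[OF f, of i] y in_M[of "Suc t"] by (auto simp: isometry_def)
  then have fx: "f ((f ^^ t) y) \<in> mcball y (\<rho> k)" using y in_M[of "Suc t"] by simp
  have "f -` mcball y (\<rho> k) \<inter> M = mcball ((f ^^ t) y) (\<rho> k)"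
    using f in_M[of t] unfolding mcball_recentre[OF fx, symmetric] by (auto simp: isometry_def Pi_iff)
  then show ?thesis using that in_M by blast
qed

lemma isometry_measurable:
  assumes f: "isometry f"
  shows "f \<in> measurable (borel_sigma_of mtopology) (borel_sigma_of mtopology)"
proof (rule measurable_sigma_sets[OF borel_eq_sigma_cells])
  show "insert {} (\<Union>k. cells k) \<subseteq> Pow M" using mcball_subset_mspace by (auto simp: cells_def)
  show "f \<in> space (borel_sigma_of mtopology) \<rightarrow> M" using f by (simp add: isometry_def)
  show "f -` B \<inter> space (borel_sigma_of mtopology) \<in> sets (borel_sigma_of mtopology)"
    if B: "B \<in> insert {} (\<Union>k. cells k)" for B
  proof (cases "B = {}")
    case False
    then obtain y k where "y \<in> M" "B = mcball y (\<rho> k)" using B by (auto simp: cells_def)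
    then show ?thesis by (metis isometry_cell_preimage[OF f] cell_in_borel space_borel_sigma_of
          topspace_mtopology)
  qed simp
qed

text \<open>Preimages of cells are cells of the same radius, so the image measure is again
  equidistributed, hence the same measure.\<close>

lemma isometry_preserves_equidistributed:
  assumes f: "isometry f" and \<mu>: "equidistributed \<mu>"
  shows "invariant_borel_prob mtopology f \<mu>"
proof -
  interpret prob_space \<mu> using \<mu> by (simp add: equidistributed_def)
  have sets: "sets \<mu> = sets (borel_sigma_of mtopology)" using \<mu> by (simp add: equidistributed_def)
  have space: "space \<mu> = M" using sets_eq_imp_space_eq[OF sets] by simp
  have meas: "f \<in> measurable \<mu> \<mu>"
    using isometry_measurable[OF f] by (simp add: measurable_cong_sets[OF sets sets])
  have "measure (distr \<mu> \<mu> f) (mcball y (\<rho> k)) = 1 / real (card (cells k))" if y: "y \<in> M" for y k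
  proof -
    obtain x where x: "x \<in> M" "f -` mcball y (\<rho> k) \<inter> M = mcball x (\<rho> k)"
      using isometry_cell_preimage[OF f y] by blast
    then show ?thesis
      using meas equidistributed_cell_mass[OF \<mu>] by (simp add: measure_distr sets space)
  qed
  then have "equidistributed (distr \<mu> \<mu> f)"
    using prob_space_distr[OF meas] by (simp add: equidistributed_def sets)
  then have eq: "distr \<mu> \<mu> f = \<mu>" using equidistributed_unique \<mu> by blast
  have "emeasure \<mu> (f -` A \<inter> space \<mu>) = emeasure \<mu> A" if "A \<in> sets \<mu>" for A
    using emeasure_distr[OF meas that] eq by simp
  then show ?thesis by (simp add: invariant_borel_prob_def prob_space_axioms sets)
qed

text \<open>If the orbit of \<open>x\<close> enters the cell of \<open>y\<close> at time \<open>N\<close>, then the whole cell of \<open>x\<close> is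
  contained in the preimage of the cell of \<open>y\<close> under the \<open>N\<close>-th iterate. So the mass of a cell cannot
  decrease along an orbit, and by minimality any two cells of one radius can be compared both ways.\<close>

lemma minimal_isometry_invariant_equidistributed:
  assumes f: "isometry f" and min: "minimal_map mtopology f"
    and inv: "invariant_borel_prob mtopology f \<nu>"
  shows "equidistributed \<nu>"
proof -
  interpret prob_space \<nu> using inv by (simp add: invariant_borel_prob_def)
  have sets: "sets \<nu> = sets (borel_sigma_of mtopology)"
    using inv by (simp add: invariant_borel_prob_def)
  have space: "space \<nu> = M" using sets_eq_imp_space_eq[OF sets] by simp
  have meas: "g \<in> measurable \<nu> \<nu>" if "isometry g" for g
    using isometry_measurable[OF that] by (simp add: measurable_cong_sets[OF sets sets])
  have iter: "measure \<nu> ((f ^^ N) -` A \<inter> M) = measure \<nu> A" if A: "A \<in> sets \<nu>" for A N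
  proof (induction N)
    case 0
    then show ?case using sets.sets_into_space[OF A] by (simp add: space Int_absorb2)
  next
    case (Suc N)
    have N: "(f ^^ N) -` A \<inter> M \<in> sets \<nu>"
      using measurable_sets[OF meas[OF isometry_funpow[OF f, of N]] A] by (simp add: space)
    have "(f ^^ Suc N) -` A \<inter> M = f -` ((f ^^ N) -` A \<inter> M) \<inter> M"
      using f by (auto simp: isometry_def Pi_iff simp flip: funpow_swap1)
    moreover have "measure \<nu> (f -` ((f ^^ N) -` A \<inter> M) \<inter> M) = measure \<nu> ((f ^^ N) -` A \<inter> M)"
      using inv N by (simp add: invariant_borel_prob_def space measure_def del: vimage_Int)
    ultimately show ?case using Suc by (simp only:)
  qed
  have le: "measure \<nu> (mcball x (\<rho> k)) \<le> measure \<nu> (mcball y (\<rho> k))" if xy: "x \<in> M" "y \<in> M" for x y k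
  proof -
    have "y \<in> mtopology closure_of {(f ^^ N) x |N. N \<in> UNIV}"
      using min xy by (simp add: minimal_map_def)
    then obtain N where N: "(f ^^ N) x \<in> mcball y (\<rho> k)"
      using radius_pos[of k] unfolding metric_closure_of_alt by blast
    have "mcball x (\<rho> k) \<subseteq> (f ^^ N) -` mcball y (\<rho> k) \<inter> M"
      using isometry_funpow[OF f, of N] xy
      unfolding mcball_recentre[OF N, symmetric] by (auto simp: isometry_def Pi_iff)
    moreover have "(f ^^ N) -` mcball y (\<rho> k) \<inter> M \<in> sets \<nu>"
      using measurable_sets[OF meas[OF isometry_funpow[OF f, of N]], of "mcball y (\<rho> k)"]
      by (simp add: space sets)
    ultimately show ?thesis using iter[of "mcball y (\<rho> k)" N] finite_measure_mono by (metis cell_in_borel sets)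
  qed
  then show ?thesis
    using prob_space_axioms sets by (auto simp: equidistributed_def intro!: antisym)
qed

text \<open>If some orbit misses a cell, the union \<open>A\<close> of the cells around its points is mapped into itself and has
  mass strictly between 0 and 1. By invariance \<open>A\<close> and its preimage differ by a null set,
  so conditioning on \<open>A\<close> produces a second invariant measure.\<close>

lemma uniquely_ergodic_isometry_minimal:
  assumes f: "isometry f" and \<mu>: "equidistributed \<mu>" and ue: "uniquely_ergodic mtopology f"
  shows "minimal_map mtopology f"
proof (rule ccontr)
  interpret prob_space \<mu> using \<mu> by (simp add: equidistributed_def)
  have sets: "sets \<mu> = sets (borel_sigma_of mtopology)" using \<mu> by (simp add: equidistributed_def)
  have space: "space \<mu> = M" using sets_eq_imp_space_eq[OF sets] by simp
  have inv: "invariant_borel_prob mtopology f \<mu>"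
    by (rule isometry_preserves_equidistributed[OF f \<mu>])
  have meas: "f \<in> measurable \<mu> \<mu>"
    using isometry_measurable[OF f] by (simp add: measurable_cong_sets[OF sets sets])
  assume "\<not> minimal_map mtopology f"
  then obtain x where x: "x \<in> M" and nd: "mtopology closure_of {(f ^^ N) x |N. N \<in> UNIV} \<noteq> M"
    by (auto simp: minimal_map_def)
  then obtain y e where y: "y \<in> M" "e > 0" and far: "\<And>N. (f ^^ N) x \<notin> mball y e"
    unfolding metric_closure_of by blast
  obtain k where k: "\<rho> k < e" using small_radius[OF y(2)] by blast
  have in_M: "(f ^^ N) x \<in> M" for N using isometry_funpow[OF f, of N] x by (auto simp: isometry_def)
  define A where "A = (\<Union>N. mcball ((f ^^ N) x) (\<rho> k))"
  have A [measurable]: "A \<in> sets \<mu>" unfolding A_def by (intro sets.countable_UN) (auto simp: sets)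
  have AM: "A \<subseteq> M" using sets.sets_into_space[OF A] by (simp add: space)
  have fA: "A \<subseteq> f -` A \<inter> M"
  proof
    fix z assume "z \<in> A"
    then obtain N where z: "z \<in> mcball ((f ^^ N) x) (\<rho> k)" by (auto simp: A_def)
    then have "f z \<in> mcball ((f ^^ Suc N) x) (\<rho> k)" using f by (auto simp: isometry_def)
    then show "z \<in> f -` A \<inter> M" using z by (auto simp: A_def simp del: funpow.simps)
  qed
  have pos: "measure \<mu> A > 0"
  proof -
    have "mcball ((f ^^ 0) x) (\<rho> k) \<subseteq> A" unfolding A_def by blast
    then have "measure \<mu> (mcball x (\<rho> k)) \<le> measure \<mu> A" by (intro finite_measure_mono) auto
    then show ?thesis using equidistributed_cell_pos[OF \<mu> x, of k] by linarith
  qed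
  have disj: "A \<inter> mcball y (\<rho> k) = {}"
  proof (rule ccontr)
    assume "A \<inter> mcball y (\<rho> k) \<noteq> {}"
    then obtain N where "mcball ((f ^^ N) x) (\<rho> k) \<inter> mcball y (\<rho> k) \<noteq> {}" by (auto simp: A_def)
    then have "mcball ((f ^^ N) x) (\<rho> k) \<subseteq> mcball y (\<rho> k)" by (rule mcball_nested[OF order_refl])
    moreover have "(f ^^ N) x \<in> mcball ((f ^^ N) x) (\<rho> k)" using in_M by simp
    ultimately have "(f ^^ N) x \<in> mcball y (\<rho> k)" by blast
    then show False using far k mcball_subset_mball_concentric by blast
  qed
  have null: "measure \<mu> (f -` A \<inter> M - A) = 0"
  proof -
    have "f -` A \<inter> M \<in> sets \<mu>" using measurable_sets[OF meas A] by (simp add: space)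
    moreover have "measure \<mu> (f -` A \<inter> M) = measure \<mu> A"
      using inv A by (simp add: invariant_borel_prob_def space measure_def)
    ultimately show ?thesis using finite_measure_Diff[of "f -` A \<inter> M" A] fA A by simp
  qed
  define \<nu> where "\<nu> = uniform_measure \<mu> A"
  have m\<nu>: "measure \<nu> B = measure \<mu> (A \<inter> B) / measure \<mu> A" if "B \<in> sets \<mu>" for B
    unfolding \<nu>_def using that pos by (intro measure_uniform_measure) (auto simp: emeasure_eq_measure)
  have prob\<nu>: "prob_space \<nu>"
    unfolding \<nu>_def by (rule prob_space_uniform_measure) (use pos in \<open>auto simp: emeasure_eq_measure\<close>)
  have "measure \<nu> (f -` B \<inter> M) = measure \<nu> B" if B: "B \<in> sets \<mu>" for B
  proof -
    have fB: "f -` B \<inter> M \<in> sets \<mu>" using measurable_sets[OF meas B] by (simp add: space)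
    have fAB: "f -` (A \<inter> B) \<inter> M \<in> sets \<mu>" using measurable_sets[OF meas, of "A \<inter> B"] A B by (simp add: space)
    have fA': "f -` A \<inter> M \<in> sets \<mu>" using measurable_sets[OF meas A] by (simp add: space)
    have sub: "A \<inter> (f -` B \<inter> M) \<subseteq> f -` (A \<inter> B) \<inter> M" using fA by blast
    \<comment> \<open>The two sets below differ only inside the preimage of \<open>A\<close> without \<open>A\<close>, a null set.\<close>
    have "measure \<mu> (f -` (A \<inter> B) \<inter> M) - measure \<mu> (A \<inter> (f -` B \<inter> M)) =
        measure \<mu> (f -` (A \<inter> B) \<inter> M - A \<inter> (f -` B \<inter> M))"
      using finite_measure_Diff[of "f -` (A \<inter> B) \<inter> M" "A \<inter> (f -` B \<inter> M)"] fAB fB A sub by auto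
    also have "\<dots> \<le> measure \<mu> (f -` A \<inter> M - A)"
      using fA' A by (intro finite_measure_mono) auto
    finally have "measure \<mu> (f -` (A \<inter> B) \<inter> M) \<le> measure \<mu> (A \<inter> (f -` B \<inter> M))" using null by simp
    moreover have "measure \<mu> (A \<inter> (f -` B \<inter> M)) \<le> measure \<mu> (f -` (A \<inter> B) \<inter> M)"
      using sub fAB by (rule finite_measure_mono)
    moreover have "measure \<mu> (f -` (A \<inter> B) \<inter> M) = measure \<mu> (A \<inter> B)"
      using inv A B by (simp add: invariant_borel_prob_def space measure_def del: vimage_Int)
    ultimately show ?thesis using m\<nu>[OF fB] m\<nu>[OF B] by simp
  qed
  moreover have "sets \<nu> = sets \<mu>" "space \<nu> = M" by (simp_all add: \<nu>_def space)
  ultimately have "invariant_borel_prob mtopology f \<nu>"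
    using prob\<nu> by (simp add: invariant_borel_prob_def sets prob_space_def finite_measure.emeasure_eq_measure)
  then have "\<nu> = \<mu>" using ue inv unfolding uniquely_ergodic_def by blast
  moreover have "measure \<nu> (mcball y (\<rho> k)) = 0" using m\<nu>[of "mcball y (\<rho> k)"] disj by (simp add: sets)
  ultimately show False using equidistributed_cell_pos[OF \<mu> y(1), of k] by simp
qed

theorem isometry_minimal_iff_uniquely_ergodic:
  assumes f: "isometry f" and \<mu>: "equidistributed \<mu>"
  shows "minimal_map mtopology f \<longleftrightarrow> uniquely_ergodic mtopology f"
    and "uniquely_ergodic mtopology f \<Longrightarrow> invariant_borel_prob mtopology f \<nu> \<longleftrightarrow> \<nu> = \<mu>"
proof -
  have inv: "invariant_borel_prob mtopology f \<mu>"
    by (rule isometry_preserves_equidistributed[OF f \<mu>])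
  show "minimal_map mtopology f \<longleftrightarrow> uniquely_ergodic mtopology f"
  proof
    assume "minimal_map mtopology f"
    then have "\<nu> = \<mu>" if "invariant_borel_prob mtopology f \<nu>" for \<nu>
      using minimal_isometry_invariant_equidistributed[OF f _ that] \<mu> equidistributed_unique by blast
    then show "uniquely_ergodic mtopology f" unfolding uniquely_ergodic_def using inv by blast
  qed (rule uniquely_ergodic_isometry_minimal[OF f \<mu>])
  show "invariant_borel_prob mtopology f \<nu> \<longleftrightarrow> \<nu> = \<mu>" if "uniquely_ergodic mtopology f"
    using that inv unfolding uniquely_ergodic_def by blast
qed

end

section \<open>Integers in the p-adic metric\<close>

lemma padic_abs_rat_one [simp]: "prime p \<Longrightarrow> padic_abs_rat p 1 = 1"
  using padic_abs_rat_quotient[of p 1 1] by simp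

lemma padic_abs_rat_of_int:
  assumes p: "prime p" and "m \<noteq> 0"
  shows "padic_abs_rat p (of_int m) = 1 / real p ^ multiplicity (int p) m"
  using padic_abs_rat_quotient[OF p assms(2), of 1] by (simp add: power_int_minus field_simps)

lemma padic_abs_rat_of_int_le_iff:
  assumes p: "prime p"
  shows "padic_abs_rat p (of_int m) \<le> 1 / real p ^ k \<longleftrightarrow> int p ^ k dvd m"
proof (cases "m = 0")
  case False
  have p1: "real p > 1" using prime_gt_1_nat[OF p] by simp
  have "int p ^ k dvd m \<longleftrightarrow> k \<le> multiplicity (int p) m"
    using False p by (intro power_dvd_iff_le_multiplicity) auto
  also have "\<dots> \<longleftrightarrow> real p ^ k \<le> real p ^ multiplicity (int p) m" using p1 by simp
  also have "\<dots> \<longleftrightarrow> padic_abs_rat p (of_int m) \<le> 1 / real p ^ k"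
    using p1 by (simp add: padic_abs_rat_of_int[OF p False] field_simps)
  finally show ?thesis by simp
qed simp

lemma padic_abs_rat_of_int_coprime:
  assumes p: "prime p" and "\<not> int p dvd m"
  shows "padic_abs_rat p (of_int m) = 1"
  using assms padic_abs_rat_of_int[OF p, of m]
  by (cases "m = 0") (simp_all add: not_dvd_imp_multiplicity_0)

text \<open>A rational number of absolute value at most 1 has a denominator prime to \<open>p\<close>, which can be
  inverted modulo \<open>p ^ k\<close>.\<close>

lemma rat_residue:
  assumes p: "prime p" and q: "padic_abs_rat p q \<le> 1"
  obtains a where "a < p ^ k" "padic_abs_rat p (q - of_nat a) \<le> 1 / real p ^ k"
proof -
  obtain u v where uv: "quotient_of q = (u, v)" by fastforce
  have v: "v > 0" using quotient_of_denom_pos[OF uv] .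
  have q_eq: "q = of_int u / of_int v" using quotient_of_div[OF uv] .
  have cop: "coprime u v" using quotient_of_coprime[OF uv] .
  have p1: "real p > 1" using prime_gt_1_nat[OF p] by simp
  have pv: "\<not> int p dvd v"
  proof
    assume dv: "int p dvd v"
    then have du: "\<not> int p dvd u" using cop p by (metis coprime_common_divisor not_prime_unit prime_nat_int_transfer)
    then have u: "u \<noteq> 0" by auto
    have mv: "multiplicity (int p) v > 0" using dv v p by (simp add: prime_multiplicity_gt_zero_iff)
    have "padic_abs_rat p q = real p ^ multiplicity (int p) v"
      using padic_abs_rat_quotient[OF p u, of v] v du by (simp add: q_eq not_dvd_imp_multiplicity_0)
    also have "\<dots> > 1" using mv p1 by (intro one_less_power) auto
    finally show False using q by simp
  qed
  have "coprime v (int p ^ k)"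
    using pv p by (metis coprime_commute coprime_power_left_iff prime_imp_coprime prime_nat_int_transfer)
  then obtain s t where st: "s * v + t * int p ^ k = 1" using bezout_int[of v "int p ^ k"] by auto
  define a where "a = nat ((u * s) mod int p ^ k)"
  have pk: "int p ^ k > 0" using prime_gt_0_nat[OF p] by simp
  have ia: "int a = (u * s) mod int p ^ k" using pk by (simp add: a_def)
  have "int a < int p ^ k" using ia pk by simp
  then have alt: "a < p ^ k" by (metis of_nat_less_iff of_nat_power)
  have "u - int a * v = u * (s * v + t * int p ^ k) - int a * v" using st by simp
  also have "\<dots> = (u * s - (u * s) mod int p ^ k) * v + u * t * int p ^ k"
    by (simp add: ia algebra_simps)
  finally have "int p ^ k dvd u - int a * v" by (simp add: minus_mod_eq_mult_div)
  then have "padic_abs_rat p (of_int (u - int a * v)) \<le> 1 / real p ^ k"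
    by (simp only: padic_abs_rat_of_int_le_iff[OF p])
  moreover have "(q - of_nat a) * of_int v = of_int (u - int a * v)" using v by (simp add: q_eq field_simps)
  ultimately have "padic_abs_rat p (q - of_nat a) \<le> 1 / real p ^ k"
    using padic_abs_rat_mult[OF p, of "q - of_nat a" "of_int v"] padic_abs_rat_of_int_coprime[OF p pv] by simp
  then show ?thesis using that alt by blast
qed

section \<open>The p-adic numbers as an ultrametric space\<close>

locale padic =
  fixes p :: nat
  assumes p: "prime p"
begin

sublocale Q: cring "Qp p" by (rule cring_Qp[OF p])
sublocale QM: Metric_space "carrier (Qp p)" "padic_dist p" by (rule Metric_space_Qp[OF p])

lemma p_gt_1: "real p > 1"
  using prime_gt_1_nat[OF p] by simp

lemma p_pos [simp]: "p > 0" and p_nonzero [simp]: "p \<noteq> 0"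
  using prime_gt_0_nat[OF p] by simp_all

definition nat_padic :: "nat \<Rightarrow> (nat \<Rightarrow> rat) set" where
  "nat_padic a = padic_class p (\<lambda>_. of_nat a)"

lemma carrierE:
  assumes "x \<in> carrier (Qp p)" obtains X where "padic_cauchy p X" "x = padic_class p X"
  using assms by (auto simp: carrier_Qp)

lemma class_closed: "padic_cauchy p X \<Longrightarrow> padic_class p X \<in> carrier (Qp p)"
  by (auto simp: carrier_Qp)

lemma class_add:
  "\<lbrakk>padic_cauchy p X; padic_cauchy p Y\<rbrakk> \<Longrightarrow>
    padic_class p X \<oplus>\<^bsub>Qp p\<^esub> padic_class p Y = padic_class p (\<lambda>i. X i + Y i)"
  using ring_hom_add[OF padic_class_hom[OF p], of X Y] by (simp add: padic_cauchy_ring_def)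

lemma class_mult:
  "\<lbrakk>padic_cauchy p X; padic_cauchy p Y\<rbrakk> \<Longrightarrow>
    padic_class p X \<otimes>\<^bsub>Qp p\<^esub> padic_class p Y = padic_class p (\<lambda>i. X i * Y i)"
  using ring_hom_mult[OF padic_class_hom[OF p], of X Y] by (simp add: padic_cauchy_ring_def)

lemma class_one: "\<one>\<^bsub>Qp p\<^esub> = padic_class p (\<lambda>_. 1)"
  using ring_hom_one[OF padic_class_hom[OF p]] by (simp add: padic_cauchy_ring_def)

lemma class_zero: "\<zero>\<^bsub>Qp p\<^esub> = padic_class p (\<lambda>_. 0)"
  using padic_class_minus[OF p padic_cauchy_const padic_cauchy_const, of 1 1]
  by (simp add: Q.minus_eq Q.r_neg flip: class_one)

lemma class_power:
  assumes "padic_cauchy p X"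
  shows "padic_cauchy p (\<lambda>i. X i ^ n) \<and> padic_class p X [^]\<^bsub>Qp p\<^esub> n = padic_class p (\<lambda>i. X i ^ n)"
proof (induction n)
  case (Suc n)
  then show ?case using padic_cauchy_mult[OF p _ assms, of "\<lambda>i. X i ^ n"] class_mult[OF _ assms]
    by (simp add: Q.nat_pow_Suc mult.commute)
qed (simp add: class_one padic_cauchy_const)

lemma nat_padic_closed [simp]: "nat_padic a \<in> carrier (Qp p)"
  unfolding nat_padic_def by (intro class_closed padic_cauchy_const)

lemma nat_padic_0: "nat_padic 0 = \<zero>\<^bsub>Qp p\<^esub>" and nat_padic_1: "nat_padic 1 = \<one>\<^bsub>Qp p\<^esub>"
  by (simp_all add: nat_padic_def class_zero class_one)

lemma dist_nat_padic: "padic_dist p (nat_padic a) (nat_padic b) = padic_abs_rat p (of_nat a - of_nat b)"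
  using padic_dist_class[OF p padic_cauchy_const[of p "of_nat a"] padic_cauchy_const[of p "of_nat b"]]
  unfolding nat_padic_def by (intro LIMSEQ_unique[OF _ tendsto_const]) auto

lemma dist_nat_padic_le_iff:
  "padic_dist p (nat_padic a) (nat_padic b) \<le> 1 / real p ^ k \<longleftrightarrow> int p ^ k dvd int a - int b"
  using padic_abs_rat_of_int_le_iff[OF p, of "int a - int b" k] by (simp add: dist_nat_padic)

lemma padic_dist_ultra:
  assumes "x \<in> carrier (Qp p)" "y \<in> carrier (Qp p)" "z \<in> carrier (Qp p)"
  shows "padic_dist p x z \<le> max (padic_dist p x y) (padic_dist p y z)"
proof -
  obtain X Y Z where *: "padic_cauchy p X" "x = padic_class p X" "padic_cauchy p Y" "y = padic_class p Y"
    "padic_cauchy p Z" "z = padic_class p Z" using assms by (metis carrierE)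
  show ?thesis unfolding *
    by (rule LIMSEQ_le[OF padic_dist_class[OF p *(1,5)]
          tendsto_max[OF padic_dist_class[OF p *(1,3)] padic_dist_class[OF p *(3,5)]]])
       (metis padic_abs_rat_ultra[OF p] diff_add_cancel add_diff_eq)
qed

lemma padic_dist_le_trans:
  assumes "padic_dist p x y \<le> r" "padic_dist p y z \<le> r"
    "x \<in> carrier (Qp p)" "y \<in> carrier (Qp p)" "z \<in> carrier (Qp p)"
  shows "padic_dist p x z \<le> r"
  using padic_dist_ultra[OF assms(3-5)] assms(1,2) by simp

lemma padic_dist_translate:
  assumes "a \<in> carrier (Qp p)" "x \<in> carrier (Qp p)" "y \<in> carrier (Qp p)"
  shows "padic_dist p (a \<oplus>\<^bsub>Qp p\<^esub> x) (a \<oplus>\<^bsub>Qp p\<^esub> y) = padic_dist p x y"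
proof -
  obtain A X Y where *: "padic_cauchy p A" "a = padic_class p A" "padic_cauchy p X" "x = padic_class p X"
    "padic_cauchy p Y" "y = padic_class p Y" using assms by (metis carrierE)
  show ?thesis unfolding *(2,4,6) class_add[OF *(1,3)] class_add[OF *(1,5)]
    using padic_dist_class[OF p padic_cauchy_add[OF p *(1,3)] padic_cauchy_add[OF p *(1,5)]]
      padic_dist_class[OF p *(3,5)] by (intro LIMSEQ_unique) auto
qed

lemma Zp_iff: "x \<in> Zp p \<longleftrightarrow> x \<in> carrier (Qp p) \<and> padic_dist p x \<zero>\<^bsub>Qp p\<^esub> \<le> 1"
  by (auto simp: Zp_def padic_dist_def Q.minus_eq)

lemma Zp_carrier: "x \<in> Zp p \<Longrightarrow> x \<in> carrier (Qp p)"
  by (simp add: Zp_iff)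

lemma Zp_near:
  assumes "y \<in> Zp p" "x \<in> carrier (Qp p)" "padic_dist p x y \<le> 1" shows "x \<in> Zp p"
  using assms by (auto simp: Zp_iff intro: padic_dist_le_trans[of x y])

lemma nat_padic_Zp [simp]: "nat_padic a \<in> Zp p"
  using dist_nat_padic_le_iff[of a 0 0] by (simp add: Zp_iff nat_padic_0)

lemma one_Zp: "\<one>\<^bsub>Qp p\<^esub> \<in> Zp p"
  using nat_padic_Zp[of 1] by (simp only: nat_padic_1)

lemma Zp_add:
  assumes "x \<in> Zp p" "y \<in> Zp p" shows "x \<oplus>\<^bsub>Qp p\<^esub> y \<in> Zp p"
proof (rule Zp_near[OF assms(1)])
  have C: "x \<in> carrier (Qp p)" "y \<in> carrier (Qp p)" using assms by (simp_all add: Zp_iff)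
  show "x \<oplus>\<^bsub>Qp p\<^esub> y \<in> carrier (Qp p)" using C by simp
  have "padic_dist p (x \<oplus>\<^bsub>Qp p\<^esub> y) x = padic_dist p y \<zero>\<^bsub>Qp p\<^esub>"
    using padic_dist_translate[OF C Q.zero_closed] C by simp
  then show "padic_dist p (x \<oplus>\<^bsub>Qp p\<^esub> y) x \<le> 1" using assms(2) by (simp add: Zp_iff)
qed

lemma Zp_uminus:
  assumes "x \<in> Zp p" shows "\<ominus>\<^bsub>Qp p\<^esub> x \<in> Zp p"
proof -
  have C: "x \<in> carrier (Qp p)" using assms by (simp add: Zp_iff)
  have "padic_dist p (\<ominus>\<^bsub>Qp p\<^esub> x) \<zero>\<^bsub>Qp p\<^esub> = padic_dist p \<zero>\<^bsub>Qp p\<^esub> x"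
    using padic_dist_translate[OF C Q.a_inv_closed[OF C] Q.zero_closed] C by (simp add: Q.r_neg)
  then show ?thesis using assms C QM.commute[of x "\<zero>\<^bsub>Qp p\<^esub>"] by (simp add: Zp_iff)
qed

text \<open>The natural numbers are dense in the p-adic integers: the terms of a representing sequence are
  eventually close to the limit, and each of them is a rational number with a residue modulo \<open>p ^ k\<close>.\<close>

lemma Zp_residue:
  assumes x: "x \<in> Zp p"
  obtains a where "a < p ^ k" "padic_dist p x (nat_padic a) \<le> 1 / real p ^ k"
proof -
  obtain X where X: "padic_cauchy p X" "x = padic_class p X" using x Zp_carrier carrierE by blast
  have ek: "1 / real p ^ k > 0" by simp
  obtain N where N: "\<And>i j. i \<ge> N \<Longrightarrow> j \<ge> N \<Longrightarrow> padic_abs_rat p (X i - X j) < 1 / real p ^ k"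
    using X(1) ek unfolding padic_cauchy_def by meson
  have const: "padic_cauchy p (\<lambda>_. X N)" by (rule padic_cauchy_const)
  let ?c = "padic_class p (\<lambda>_. X N)"
  have c: "?c \<in> carrier (Qp p)" by (rule class_closed[OF const])
  have near: "padic_dist p x ?c \<le> 1 / real p ^ k"
    unfolding X(2)
    by (rule LIMSEQ_le_const2[OF padic_dist_class[OF p X(1) const]]) (use N in \<open>meson less_imp_le order_refl\<close>)
  have "1 / real p ^ k \<le> 1" using p_gt_1 by simp
  then have "padic_dist p ?c x \<le> 1" using near by (subst QM.commute) linarith
  then have "?c \<in> Zp p" by (rule Zp_near[OF x c])
  moreover have "padic_dist p ?c \<zero>\<^bsub>Qp p\<^esub> = padic_abs_rat p (X N)"
    using padic_dist_class[OF p const padic_cauchy_const[of p 0]]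
    unfolding class_zero by (intro LIMSEQ_unique[OF _ tendsto_const]) auto
  ultimately have "padic_abs_rat p (X N) \<le> 1" by (simp add: Zp_iff)
  then obtain a where a: "a < p ^ k" "padic_abs_rat p (X N - of_nat a) \<le> 1 / real p ^ k"
    by (rule rat_residue[OF p])
  have "padic_dist p ?c (nat_padic a) = padic_abs_rat p (X N - of_nat a)"
    using padic_dist_class[OF p const padic_cauchy_const[of p "of_nat a"]]
    unfolding nat_padic_def by (intro LIMSEQ_unique[OF _ tendsto_const]) auto
  then have "padic_dist p x (nat_padic a) \<le> 1 / real p ^ k"
    using padic_dist_le_trans[OF near _ Zp_carrier[OF x] c, of "nat_padic a"] a(2) by simp
  then show ?thesis using that a(1) by blast
qed

lemma subset_Zp_totally_bounded:
  assumes X: "X \<subseteq> Zp p"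
  shows "totally_bounded_ultrametric X (padic_dist p) (\<lambda>k. 1 / real p ^ (k + m))"
proof -
  have XC: "X \<subseteq> carrier (Qp p)" using X Zp_carrier by blast
  interpret X: Metric_space X "padic_dist p" using QM.subspace[OF XC] .
  show ?thesis
  proof
    show "padic_dist p x z \<le> max (padic_dist p x y) (padic_dist p y z)" if "x \<in> X" "y \<in> X" "z \<in> X" for x y z
      using padic_dist_ultra that XC by blast
    show "1 / real p ^ (k + m) > 0" for k by simp
    have "(\<lambda>k. (1 / real p) ^ k) \<longlonglongrightarrow> 0" using p_gt_1 by (intro LIMSEQ_power_zero) auto
    from LIMSEQ_ignore_initial_segment[OF this, of m]
    show "(\<lambda>k. 1 / real p ^ (k + m)) \<longlonglongrightarrow> 0" by (simp add: power_one_over)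
    show "finite ((\<lambda>x. X.mcball x (1 / real p ^ (k + m))) ` X)" for k
    proof (rule finite_surj[of "{..<p ^ (k + m)}"])
      let ?r = "1 / real p ^ (k + m)"
      show "(\<lambda>x. X.mcball x ?r) ` X \<subseteq> (\<lambda>a. {y \<in> X. padic_dist p (nat_padic a) y \<le> ?r}) ` {..<p ^ (k + m)}"
      proof
        fix B assume "B \<in> (\<lambda>x. X.mcball x ?r) ` X"
        then obtain x where x: "x \<in> X" "B = X.mcball x ?r" by blast
        obtain a where a: "a < p ^ (k + m)" "padic_dist p x (nat_padic a) \<le> ?r"
          using Zp_residue x X by blast
        have "padic_dist p x y \<le> ?r \<longleftrightarrow> padic_dist p (nat_padic a) y \<le> ?r" if "y \<in> X" for y
          using padic_dist_le_trans[of x "nat_padic a" _ y] padic_dist_le_trans[of "nat_padic a" x _ y]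
            QM.commute[of x "nat_padic a"] that x(1) a(2) XC by (metis nat_padic_closed subsetD)
        then have "B = {y \<in> X. padic_dist p (nat_padic a) y \<le> ?r}" using x by auto
        then show "B \<in> (\<lambda>a. {y \<in> X. padic_dist p (nat_padic a) y \<le> ?r}) ` {..<p ^ (k + m)}"
          using a(1) by blast
      qed
    qed simp
  qed
qed

lemma mtopology_subset:
  assumes "X \<subseteq> carrier (Qp p)"
  shows "Metric_space.mtopology X (padic_dist p) = subtopology (padic_topology p) X"
proof -
  interpret Submetric "carrier (Qp p)" "padic_dist p" X by unfold_locales (rule assms)
  show ?thesis using mtopology_submetric by (simp add: padic_topology_def)
qed

sublocale Z: totally_bounded_ultrametric "Zp p" "padic_dist p" "\<lambda>k. 1 / real p ^ k"
  using subset_Zp_totally_bounded[of "Zp p" 0] by simp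

lemma mtopology_Zp: "Z.mtopology = subtopology (padic_topology p) (Zp p)"
  by (rule mtopology_subset) (use Zp_carrier in blast)

section \<open>Haar measure on the p-adic integers\<close>

definition digit_sum :: "(nat \<Rightarrow> nat) \<Rightarrow> nat \<Rightarrow> nat" where
  "digit_sum c k = (\<Sum>j<k. c j * p ^ j)"

definition digit_series :: "(nat \<Rightarrow> nat) \<Rightarrow> (nat \<Rightarrow> rat) set" where
  "digit_series c = padic_class p (\<lambda>k. of_nat (digit_sum c k))"

definition random_digits :: "(nat \<Rightarrow> nat) measure" where
  "random_digits = PiM UNIV (\<lambda>_. uniform_count_measure {..<p})"

lemma digit_sum_Suc: "digit_sum c (Suc k) = digit_sum c k + c k * p ^ k"
  by (simp add: digit_sum_def)

lemma digit_sum_less: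
  assumes "\<And>j. c j < p" shows "digit_sum c k < p ^ k"
proof (induction k)
  case (Suc k)
  have "digit_sum c (Suc k) < (c k + 1) * p ^ k" using Suc by (simp add: digit_sum_Suc)
  also have "\<dots> \<le> p * p ^ k" using assms[of k] by (intro mult_right_mono) auto
  finally show ?case by simp
qed (simp add: digit_sum_def)

lemma digit_sum_digits: "digit_sum (\<lambda>j. a div p ^ j mod p) k = a mod p ^ k"
proof (induction k)
  case (Suc k)
  then show ?case using mod_mult2_eq[of a "p ^ k" p] by (simp add: digit_sum_Suc mult.commute)
qed (simp add: digit_sum_def)

lemma digit_sum_inj:
  assumes "\<And>j. c j < p" "\<And>j. e j < p" "digit_sum c k = digit_sum e k" "j < k"
  shows "c j = e j"
  using assms(3,4)
proof (induction k)
  case (Suc k)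
  have less: "digit_sum c k < p ^ k" "digit_sum e k < p ^ k" using digit_sum_less assms(1,2) by auto
  have "digit_sum c (Suc k) mod p ^ k = digit_sum c k" "digit_sum e (Suc k) mod p ^ k = digit_sum e k"
    using less by (simp_all add: digit_sum_Suc)
  then have eq: "digit_sum c k = digit_sum e k" using Suc.prems(1) by simp
  then have "c k = e k" using Suc.prems(1) by (simp add: digit_sum_Suc)
  then show ?case using Suc eq by (metis less_antisym)
qed simp

lemma digit_sum_eq_iff:
  assumes c: "\<And>j. c j < p" and a: "a < p ^ k"
  shows "digit_sum c k = a \<longleftrightarrow> (\<forall>j\<in>{..<k}. c j \<in> {a div p ^ j mod p})"
proof
  assume "digit_sum c k = a"
  then have "digit_sum c k = digit_sum (\<lambda>j. a div p ^ j mod p) k" using digit_sum_digits a by simp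
  then show "\<forall>j\<in>{..<k}. c j \<in> {a div p ^ j mod p}"
    using digit_sum_inj[of c "\<lambda>j. a div p ^ j mod p" k] c by simp
next
  assume "\<forall>j\<in>{..<k}. c j \<in> {a div p ^ j mod p}"
  then have "digit_sum c k = digit_sum (\<lambda>j. a div p ^ j mod p) k" by (simp add: digit_sum_def)
  then show "digit_sum c k = a" using digit_sum_digits a by simp
qed

lemma digit_sum_tail:
  assumes "k \<le> i" shows "int p ^ k dvd int (digit_sum c i) - int (digit_sum c k)"
  using assms
proof (induction i rule: dec_induct)
  case (step i)
  have "int p ^ k dvd int p ^ i" using step by (simp add: le_imp_power_dvd)
  then have "int p ^ k dvd (int (digit_sum c i) - int (digit_sum c k)) + int (c i) * int p ^ i"
    using step by (intro dvd_add) auto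
  then show ?case by (simp add: digit_sum_Suc algebra_simps)
qed simp

lemma digit_sum_tail_le:
  assumes "k \<le> i"
  shows "padic_abs_rat p (of_nat (digit_sum c i) - of_nat (digit_sum c k)) \<le> 1 / real p ^ k"
  using digit_sum_tail[OF assms, of c] padic_abs_rat_of_int_le_iff[OF p, of "int (digit_sum c i) - int (digit_sum c k)" k]
  by simp

lemma digit_sum_cauchy: "padic_cauchy p (\<lambda>k. of_nat (digit_sum c k))"
  unfolding padic_cauchy_def
proof (intro allI impI)
  fix e :: real assume "e > 0"
  then obtain k where k: "1 / real p ^ k < e" using Z.small_radius by blast
  let ?s = "\<lambda>k. of_nat (digit_sum c k) :: rat"
  have "padic_abs_rat p (?s i - ?s j) < e" if "i \<ge> k" "j \<ge> k" for i j
    using padic_abs_rat_ultra[OF p, of "?s i - ?s k" "?s k - ?s j"] digit_sum_tail_le[OF that(1), of c]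
      digit_sum_tail_le[OF that(2), of c] padic_abs_rat_diff_commute[OF p, of "?s j" "?s k"] k by simp
  then show "\<exists>N. \<forall>i\<ge>N. \<forall>j\<ge>N. padic_abs_rat p (?s i - ?s j) < e" by blast
qed

lemma dist_digit_series: "padic_dist p (digit_series c) (nat_padic (digit_sum c k)) \<le> 1 / real p ^ k"
  unfolding digit_series_def nat_padic_def
  by (rule LIMSEQ_le_const2[OF padic_dist_class[OF p digit_sum_cauchy padic_cauchy_const]])
     (use digit_sum_tail_le in blast)

lemma digit_series_Zp: "digit_series c \<in> Zp p"
proof (rule Zp_near[of "nat_padic (digit_sum c 0)"])
  show "digit_series c \<in> carrier (Qp p)"
    unfolding digit_series_def by (rule class_closed[OF digit_sum_cauchy])
qed (use dist_digit_series[of c 0] in auto)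

lemma dist_digit_series_le_iff:
  assumes c: "\<And>j. c j < p" and a: "a < p ^ k"
  shows "padic_dist p (nat_padic a) (digit_series c) \<le> 1 / real p ^ k \<longleftrightarrow> digit_sum c k = a"
proof
  assume "padic_dist p (nat_padic a) (digit_series c) \<le> 1 / real p ^ k"
  then have "padic_dist p (nat_padic (digit_sum c k)) (nat_padic a) \<le> 1 / real p ^ k"
    using padic_dist_ultra[of "nat_padic (digit_sum c k)" "digit_series c" "nat_padic a"]
      dist_digit_series[of c k] Zp_carrier[OF digit_series_Zp] by (simp add: QM.commute)
  then have "int (p ^ k) dvd int (digit_sum c k) - int a" by (simp add: dist_nat_padic_le_iff)
  then have "int (digit_sum c k) mod int (p ^ k) = int a mod int (p ^ k)" by (simp only: mod_eq_dvd_iff)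
  then have "digit_sum c k mod p ^ k = a mod p ^ k" by (simp only: of_nat_eq_iff flip: zmod_int)
  then show "digit_sum c k = a" using digit_sum_less[OF c] a by simp
qed (use dist_digit_series[of c k] in \<open>auto simp: QM.commute\<close>)

lemma Z_cell_nat:
  assumes "x \<in> Zp p"
  obtains a where "a < p ^ k" "Z.mcball x (1 / real p ^ k) = Z.mcball (nat_padic a) (1 / real p ^ k)"
proof -
  obtain a where a: "a < p ^ k" "padic_dist p x (nat_padic a) \<le> 1 / real p ^ k"
    using Zp_residue[OF assms] by blast
  then have "nat_padic a \<in> Z.mcball x (1 / real p ^ k)" using assms by simp
  then show ?thesis using that a(1) Z.mcball_recentre by blast
qed

lemma space_random_digits: "space random_digits = {c. \<forall>j. c j < p}"
  by (auto simp: random_digits_def space_PiM space_uniform_count_measure PiE_iff)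

lemma prob_space_digit: "prob_space (uniform_count_measure {..<p})"
  by (intro prob_space_uniform_count_measure) (auto simp: lessThan_empty_iff)

text \<open>A cell of radius \<open>p ^ -k\<close> prescribes the first \<open>k\<close> digits.\<close>

lemma digit_cylinder:
  assumes "a < p ^ k"
  shows "{c \<in> space random_digits. digit_sum c k = a} \<in> sets random_digits"
    and "emeasure random_digits {c \<in> space random_digits. digit_sum c k = a} = (1 / real p) ^ k"
proof -
  have eq: "{c \<in> space random_digits. digit_sum c k = a} =
      {c \<in> space random_digits. \<forall>j\<in>{..<k}. c j \<in> {a div p ^ j mod p}}"
    using digit_sum_eq_iff[OF _ assms] unfolding space_random_digits by blast
  interpret product_prob_space "\<lambda>_::nat. uniform_count_measure {..<p}" UNIV
    using prob_space_digit by (intro product_prob_spaceI)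
  have dig: "{a div p ^ j mod p} \<subseteq> {..<p}" for j using p_pos by simp
  have "emeasure random_digits {c \<in> space random_digits. digit_sum c k = a} =
      (\<Prod>j<k. emeasure (uniform_count_measure {..<p}) {a div p ^ j mod p})"
    unfolding eq unfolding random_digits_def using dig
    by (intro emeasure_PiM_Collect) (auto simp: sets_uniform_count_measure)
  also have "\<dots> = (\<Prod>j<k. ennreal (1 / real p))"
    using dig by (intro prod.cong) (simp_all add: emeasure_uniform_count_measure)
  finally show "emeasure random_digits {c \<in> space random_digits. digit_sum c k = a} = (1 / real p) ^ k"
    by (simp add: ennreal_power)
  show "{c \<in> space random_digits. digit_sum c k = a} \<in> sets random_digits"
    unfolding eq unfolding random_digits_def using dig
    by (intro sets.sets_Collect_finite_All sets_Collect_single') (auto simp: sets_uniform_count_measure space_uniform_count_measure)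
qed

lemma digit_series_vimage_cell:
  assumes "a < p ^ k"
  shows "digit_series -` Z.mcball (nat_padic a) (1 / real p ^ k) \<inter> space random_digits =
    {c \<in> space random_digits. digit_sum c k = a}"
  using dist_digit_series_le_iff[OF _ assms] digit_series_Zp by (auto simp: space_random_digits)

lemma digit_series_measurable:
  "digit_series \<in> measurable random_digits (borel_sigma_of Z.mtopology)"
proof (rule measurable_sigma_sets[OF Z.borel_eq_sigma_cells])
  show "insert {} (\<Union>k. Z.cells k) \<subseteq> Pow (Zp p)" using Z.mcball_subset_mspace by (auto simp: Z.cells_def)
  show "digit_series \<in> space random_digits \<rightarrow> Zp p" using digit_series_Zp by simp
  fix B assume B: "B \<in> insert {} (\<Union>k. Z.cells k)"
  show "digit_series -` B \<inter> space random_digits \<in> sets random_digits"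
  proof (cases "B = {}")
    case False
    then obtain x k where x: "x \<in> Zp p" "B = Z.mcball x (1 / real p ^ k)" using B by (auto simp: Z.cells_def)
    obtain a where "a < p ^ k" "Z.mcball x (1 / real p ^ k) = Z.mcball (nat_padic a) (1 / real p ^ k)"
      using Z_cell_nat[OF x(1)] .
    then show ?thesis using digit_cylinder(1) by (simp only: x(2) digit_series_vimage_cell)
  qed simp
qed

lemma digit_series_equidistributed:
  "Z.equidistributed (distr random_digits (borel_sigma_of Z.mtopology) digit_series)" (is "Z.equidistributed ?\<mu>")
proof -
  have "measure ?\<mu> (Z.mcball x (1 / real p ^ k)) = (1 / real p) ^ k" if x: "x \<in> Zp p" for x k
  proof -
    obtain a where a: "a < p ^ k" "Z.mcball x (1 / real p ^ k) = Z.mcball (nat_padic a) (1 / real p ^ k)"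
      using Z_cell_nat[OF x] .
    have "measure ?\<mu> (Z.mcball (nat_padic a) (1 / real p ^ k)) =
        measure random_digits {c \<in> space random_digits. digit_sum c k = a}"
      using measure_distr[OF digit_series_measurable Z.cell_in_borel] digit_series_vimage_cell[OF a(1)] by simp
    then show ?thesis using a digit_cylinder(2)[OF a(1)] by (simp add: measure_def)
  qed
  moreover have "prob_space ?\<mu>"
    using digit_series_measurable prob_space_digit
    by (intro prob_space.prob_space_distr) (auto simp: random_digits_def intro!: prob_space_PiM)
  ultimately show ?thesis by (simp add: Z.equidistributed_def)
qed

lemma translation_isometry: "a \<in> Zp p \<Longrightarrow> Z.isometry (\<lambda>x. a \<oplus>\<^bsub>Qp p\<^esub> x)"
  using Zp_add padic_dist_translate Zp_carrier by (auto simp: Z.isometry_def)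

lemma translate_cancel:
  assumes "a \<in> carrier (Qp p)" "x \<in> carrier (Qp p)"
  shows "a \<oplus>\<^bsub>Qp p\<^esub> (\<ominus>\<^bsub>Qp p\<^esub> a \<oplus>\<^bsub>Qp p\<^esub> x) = x" "\<ominus>\<^bsub>Qp p\<^esub> a \<oplus>\<^bsub>Qp p\<^esub> (a \<oplus>\<^bsub>Qp p\<^esub> x) = x"
  using assms by (simp_all add: Q.r_neg1 Q.r_neg2)

text \<open>Haar measure is characterised by images under translations, invariance under a map by preimages.\<close>

lemma translate_image:
  assumes a: "a \<in> Zp p" and A: "A \<subseteq> Zp p"
  shows "(\<lambda>x. a \<oplus>\<^bsub>Qp p\<^esub> x) ` A = (\<lambda>x. \<ominus>\<^bsub>Qp p\<^esub> a \<oplus>\<^bsub>Qp p\<^esub> x) -` A \<inter> Zp p"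
proof (intro equalityI subsetI)
  fix y assume "y \<in> (\<lambda>x. a \<oplus>\<^bsub>Qp p\<^esub> x) ` A"
  then show "y \<in> (\<lambda>x. \<ominus>\<^bsub>Qp p\<^esub> a \<oplus>\<^bsub>Qp p\<^esub> x) -` A \<inter> Zp p"
    using a A Zp_add translate_cancel(2) Zp_carrier by (auto simp: subset_iff)
next
  fix y assume y: "y \<in> (\<lambda>x. \<ominus>\<^bsub>Qp p\<^esub> a \<oplus>\<^bsub>Qp p\<^esub> x) -` A \<inter> Zp p"
  then have "y = a \<oplus>\<^bsub>Qp p\<^esub> (\<ominus>\<^bsub>Qp p\<^esub> a \<oplus>\<^bsub>Qp p\<^esub> y)" using translate_cancel(1) a Zp_carrier by auto
  then show "y \<in> (\<lambda>x. a \<oplus>\<^bsub>Qp p\<^esub> x) ` A" using y by blast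
qed

text \<open>Translations are isometries, and translation by \<open>y - x\<close> maps each cell around \<open>x\<close> onto the cell of the
  same radius around \<open>y\<close>.\<close>

lemma equidistributed_iff_translation_invariant:
  "Z.equidistributed \<mu> \<longleftrightarrow>
    prob_space \<mu> \<and> sets \<mu> = sets (borel_sigma_of (subtopology (padic_topology p) (Zp p))) \<and>
    (\<forall>a\<in>Zp p. \<forall>A\<in>sets \<mu>. emeasure \<mu> ((\<lambda>x. a \<oplus>\<^bsub>Qp p\<^esub> x) ` A) = emeasure \<mu> A)"
proof
  assume \<mu>: "Z.equidistributed \<mu>"
  then have sets: "sets \<mu> = sets (borel_sigma_of Z.mtopology)" by (simp add: Z.equidistributed_def)
  have space: "space \<mu> = Zp p" using sets_eq_imp_space_eq[OF sets] by simp
  have "emeasure \<mu> ((\<lambda>x. a \<oplus>\<^bsub>Qp p\<^esub> x) ` A) = emeasure \<mu> A" if a: "a \<in> Zp p" and A: "A \<in> sets \<mu>" for a A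
    using Z.isometry_preserves_equidistributed[OF translation_isometry[OF Zp_uminus[OF a]] \<mu>] A
      translate_image[OF a] sets.sets_into_space[OF A] by (simp add: invariant_borel_prob_def space)
  then show "prob_space \<mu> \<and> sets \<mu> = sets (borel_sigma_of (subtopology (padic_topology p) (Zp p))) \<and>
    (\<forall>a\<in>Zp p. \<forall>A\<in>sets \<mu>. emeasure \<mu> ((\<lambda>x. a \<oplus>\<^bsub>Qp p\<^esub> x) ` A) = emeasure \<mu> A)"
    using \<mu> by (simp add: Z.equidistributed_def mtopology_Zp)
next
  assume *: "prob_space \<mu> \<and> sets \<mu> = sets (borel_sigma_of (subtopology (padic_topology p) (Zp p))) \<and>
    (\<forall>a\<in>Zp p. \<forall>A\<in>sets \<mu>. emeasure \<mu> ((\<lambda>x. a \<oplus>\<^bsub>Qp p\<^esub> x) ` A) = emeasure \<mu> A)"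
  have "measure \<mu> (Z.mcball x (1 / real p ^ k)) = measure \<mu> (Z.mcball y (1 / real p ^ k))"
    if xy: "x \<in> Zp p" "y \<in> Zp p" for x y k
  proof -
    note C = Zp_carrier[OF xy(1)] Zp_carrier[OF xy(2)]
    obtain a where a: "a \<in> Zp p" and y: "a \<oplus>\<^bsub>Qp p\<^esub> x = y"
    proof
      show "y \<oplus>\<^bsub>Qp p\<^esub> \<ominus>\<^bsub>Qp p\<^esub> x \<in> Zp p" using xy Zp_add Zp_uminus by blast
      show "y \<oplus>\<^bsub>Qp p\<^esub> \<ominus>\<^bsub>Qp p\<^esub> x \<oplus>\<^bsub>Qp p\<^esub> x = y" using C by (simp add: Q.a_assoc Q.l_neg)
    qed
    have shift: "\<ominus>\<^bsub>Qp p\<^esub> a \<oplus>\<^bsub>Qp p\<^esub> z \<in> Zp p"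
      "padic_dist p x (\<ominus>\<^bsub>Qp p\<^esub> a \<oplus>\<^bsub>Qp p\<^esub> z) = padic_dist p y z" if "z \<in> Zp p" for z
    proof -
      show *: "\<ominus>\<^bsub>Qp p\<^esub> a \<oplus>\<^bsub>Qp p\<^esub> z \<in> Zp p" by (rule Zp_add[OF Zp_uminus[OF a] that])
      show "padic_dist p x (\<ominus>\<^bsub>Qp p\<^esub> a \<oplus>\<^bsub>Qp p\<^esub> z) = padic_dist p y z"
        using padic_dist_translate[OF Zp_carrier[OF a] C(1) Zp_carrier[OF *]]
        by (simp only: translate_cancel(1)[OF Zp_carrier[OF a] Zp_carrier[OF that]] y)
    qed
    have "(\<lambda>z. a \<oplus>\<^bsub>Qp p\<^esub> z) ` Z.mcball x (1 / real p ^ k) = Z.mcball y (1 / real p ^ k)"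
      unfolding translate_image[OF a Z.mcball_subset_mspace]
      using xy shift by auto
    moreover have "Z.mcball x (1 / real p ^ k) \<in> sets \<mu>" using * Z.cell_in_borel by (simp add: mtopology_Zp)
    ultimately have "emeasure \<mu> (Z.mcball y (1 / real p ^ k)) = emeasure \<mu> (Z.mcball x (1 / real p ^ k))"
      using * a by fastforce
    then show ?thesis by (simp add: measure_def)
  qed
  then show "Z.equidistributed \<mu>" using * unfolding Z.equidistributed_def mtopology_Zp by blast
qed

lemma Zp_haar_equidistributed: "Z.equidistributed (Zp_haar p)"
  unfolding Zp_haar_def equidistributed_iff_translation_invariant[symmetric]
  by (rule theI[of Z.equidistributed, OF digit_series_equidistributed])
     (rule Z.equidistributed_unique[OF _ digit_series_equidistributed])

end

section \<open>The power map on a sphere around 1\<close>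

lemma near_one_mult:
  assumes p: "prime p" and x: "padic_abs_rat p (x - 1) < 1" and y: "padic_abs_rat p (y - 1) < 1"
  shows "padic_abs_rat p (x * y - 1) < 1"
proof -
  have "padic_abs_rat p x \<le> 1"
    using padic_abs_rat_ultra[OF p, of "x - 1" 1] x p by simp
  then have "padic_abs_rat p (x * (y - 1)) \<le> padic_abs_rat p (y - 1)"
    by (simp add: padic_abs_rat_mult[OF p] mult_left_le_one_le)
  then have "padic_abs_rat p (x * (y - 1) + (x - 1)) < 1"
    using padic_abs_rat_ultra[OF p, of "x * (y - 1)" "x - 1"] x y by linarith
  then show ?thesis by (simp add: algebra_simps)
qed

lemma near_one_power:
  assumes p: "prime p" and x: "padic_abs_rat p (x - 1) < 1"
  shows "padic_abs_rat p (x ^ n - 1) < 1"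
  by (induction n) (use near_one_mult[OF p x] in simp_all)

lemma padic_abs_rat_sum_less:
  fixes n :: nat
  assumes p: "prime p" and "\<And>i. i < n \<Longrightarrow> padic_abs_rat p (f i) < 1"
  shows "padic_abs_rat p (\<Sum>i<n. f i) < 1"
  using assms(2)
proof (induction n)
  case (Suc n)
  have "padic_abs_rat p (\<Sum>i<n. f i) < 1" "padic_abs_rat p (f n) < 1" using Suc by simp_all
  then show ?case using padic_abs_rat_ultra[OF p, of "\<Sum>i<n. f i" "f n"] by simp
qed simp

text \<open>In \<open>x ^ n - y ^ n = (x - y) * s\<close> all \<open>n\<close> terms of the sum \<open>s\<close> are congruent to 1 modulo \<open>p\<close>,
  so \<open>s\<close> is congruent to \<open>n\<close> and thus a unit.\<close>

lemma padic_abs_rat_power_diff: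
  assumes p: "prime p" and n: "\<not> p dvd n"
    and x: "padic_abs_rat p (x - 1) < 1" and y: "padic_abs_rat p (y - 1) < 1"
  shows "padic_abs_rat p (x ^ n - y ^ n) = padic_abs_rat p (x - y)"
proof -
  define s where "s = (\<Sum>i<n. y ^ (n - Suc i) * x ^ i)"
  have "padic_abs_rat p (\<Sum>i<n. y ^ (n - Suc i) * x ^ i - 1) < 1"
    by (intro padic_abs_rat_sum_less near_one_mult near_one_power p x y)
  then have s: "padic_abs_rat p (s - of_nat n) < 1" by (simp add: s_def sum_subtractf)
  have "padic_abs_rat p (of_nat n) = 1"
    using padic_abs_rat_of_int_coprime[OF p, of "int n"] n by simp
  moreover have "padic_abs_rat p s \<le> max (padic_abs_rat p (s - of_nat n)) (padic_abs_rat p (of_nat n))"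
    using padic_abs_rat_ultra[OF p, of "s - of_nat n" "of_nat n"] by simp
  moreover have "padic_abs_rat p (of_nat n) \<le> max (padic_abs_rat p (s - of_nat n)) (padic_abs_rat p s)"
    using padic_abs_rat_ultra[OF p, of "of_nat n - s" s] padic_abs_rat_diff_commute[OF p, of "of_nat n" s] by simp
  ultimately have "padic_abs_rat p s = 1" using s by linarith
  then show ?thesis
    using power_diff_sumr2[of x n y] padic_abs_rat_mult[OF p, of "x - y" s] by (simp add: s_def)
qed

context padic
begin

lemma padic_dist_power:
  assumes n: "\<not> p dvd n" and x: "x \<in> carrier (Qp p)" "padic_dist p x \<one>\<^bsub>Qp p\<^esub> < 1"
    and y: "y \<in> carrier (Qp p)" "padic_dist p y \<one>\<^bsub>Qp p\<^esub> < 1"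
  shows "padic_dist p (x [^]\<^bsub>Qp p\<^esub> n) (y [^]\<^bsub>Qp p\<^esub> n) = padic_dist p x y"
proof -
  obtain X Y where X: "padic_cauchy p X" "x = padic_class p X" and Y: "padic_cauchy p Y" "y = padic_class p Y"
    using x(1) y(1) by (metis carrierE)
  have near: "\<forall>\<^sub>F i in sequentially. padic_abs_rat p (Z i - 1) < 1"
    if "padic_cauchy p Z" "padic_dist p (padic_class p Z) \<one>\<^bsub>Qp p\<^esub> < 1" for Z
    using order_tendstoD(2)[OF padic_dist_class[OF p that(1) padic_cauchy_const[of p 1]]] that(2)
    by (simp add: class_one)
  have "\<forall>\<^sub>F i in sequentially. padic_abs_rat p (X i ^ n - Y i ^ n) = padic_abs_rat p (X i - Y i)"
    using near[OF X(1)] near[OF Y(1)] x(2) y(2) unfolding X(2) Y(2)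
    by (auto elim: eventually_elim2 simp: padic_abs_rat_power_diff[OF p n])
  moreover have "(\<lambda>i. padic_abs_rat p (X i ^ n - Y i ^ n)) \<longlonglongrightarrow> padic_dist p (x [^]\<^bsub>Qp p\<^esub> n) (y [^]\<^bsub>Qp p\<^esub> n)"
    using padic_dist_class[OF p, of "\<lambda>i. X i ^ n" "\<lambda>i. Y i ^ n"] class_power[OF X(1), of n] class_power[OF Y(1), of n]
    by (simp add: X(2) Y(2))
  ultimately have "(\<lambda>i. padic_abs_rat p (X i - Y i)) \<longlonglongrightarrow> padic_dist p (x [^]\<^bsub>Qp p\<^esub> n) (y [^]\<^bsub>Qp p\<^esub> n)"
    by (rule Lim_transform_eventually[rotated])
  then show ?thesis using padic_dist_class[OF p X(1) Y(1)] X(2) Y(2) by (auto intro: LIMSEQ_unique)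
qed

lemma sphere_iff:
  "x \<in> padic_sphere1 p l \<longleftrightarrow> x \<in> carrier (Qp p) \<and> padic_dist p x \<one>\<^bsub>Qp p\<^esub> = 1 / real p ^ l"
  by (auto simp: padic_sphere1_def padic_dist_def)

lemma sphere_subset_Zp: "padic_sphere1 p l \<subseteq> Zp p"
proof
  fix x assume "x \<in> padic_sphere1 p l"
  moreover have "1 / real p ^ l \<le> 1" using p_gt_1 by simp
  ultimately show "x \<in> Zp p" by (intro Zp_near[OF one_Zp]) (simp_all add: sphere_iff)
qed

lemma sphere_nonempty: "nat_padic (1 + p ^ l) \<in> padic_sphere1 p l"
proof -
  have "multiplicity (int p) (int p ^ l) = l" using p by (intro multiplicity_same_power) auto
  then have "padic_abs_rat p (of_int (int p ^ l)) = 1 / real p ^ l"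
    using padic_abs_rat_of_int[OF p, of "int p ^ l"] by simp
  then have "padic_dist p (nat_padic (1 + p ^ l)) (nat_padic 1) = 1 / real p ^ l"
    unfolding dist_nat_padic by simp
  then show ?thesis by (simp add: sphere_iff flip: nat_padic_1)
qed

text \<open>Restricting to radii below \<open>p ^ -l\<close> makes the cells of the sphere full residue classes.\<close>

sublocale S: totally_bounded_ultrametric "padic_sphere1 p l" "padic_dist p" "\<lambda>k. 1 / real p ^ (k + Suc l)" for l
  by (rule subset_Zp_totally_bounded[OF sphere_subset_Zp])

lemma mtopology_sphere: "S.mtopology l = subtopology (padic_topology p) (padic_sphere1 p l)"
  by (rule mtopology_subset) (use sphere_subset_Zp Zp_carrier in blast)

lemma power_isometry:
  assumes n: "\<not> p dvd n" and l: "l \<ge> 1"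
  shows "S.isometry l (\<lambda>x. x [^]\<^bsub>Qp p\<^esub> n)"
proof -
  have near: "padic_dist p x \<one>\<^bsub>Qp p\<^esub> < 1" if "x \<in> padic_sphere1 p l" for x
    using that l p_gt_1 by (simp add: sphere_iff)
  have one: "padic_dist p \<one>\<^bsub>Qp p\<^esub> \<one>\<^bsub>Qp p\<^esub> < 1" by simp
  have "x [^]\<^bsub>Qp p\<^esub> n \<in> padic_sphere1 p l" if "x \<in> padic_sphere1 p l" for x
    using that padic_dist_power[OF n _ near[OF that] Q.one_closed one] by (simp add: sphere_iff)
  then show ?thesis
    using padic_dist_power[OF n] near by (auto simp: S.isometry_def sphere_iff)
qed

text \<open>A point that is closer to \<open>x\<close> than 1 is lies at the same distance from 1 as \<open>x\<close>.\<close>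

lemma sphere_cell:
  assumes x: "x \<in> padic_sphere1 p l"
  shows "S.mcball l x (1 / real p ^ (k + Suc l)) = Z.mcball x (1 / real p ^ (k + Suc l))"
proof -
  have "real p ^ l < real p ^ (k + Suc l)" using p_gt_1 by (intro power_strict_increasing) auto
  then have less: "1 / real p ^ (k + Suc l) < 1 / real p ^ l" by (intro divide_strict_left_mono) auto
  have "y \<in> padic_sphere1 p l" if y: "y \<in> Zp p" "padic_dist p x y \<le> 1 / real p ^ (k + Suc l)" for y
    using padic_dist_ultra[of x y "\<one>\<^bsub>Qp p\<^esub>"] padic_dist_ultra[of y x "\<one>\<^bsub>Qp p\<^esub>"] QM.commute[of x y]
      less x y Zp_carrier[OF y(1)] unfolding sphere_iff by (smt (verit) Q.one_closed)
  then show ?thesis using x sphere_subset_Zp[of l] by (auto dest: subsetD)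
qed

lemma sphere_borel: "padic_sphere1 p l \<in> sets (borel_sigma_of Z.mtopology)"
proof -
  have "padic_sphere1 p l = Z.mcball \<one>\<^bsub>Qp p\<^esub> (1 / real p ^ l) - Z.mball \<one>\<^bsub>Qp p\<^esub> (1 / real p ^ l)"
    using one_Zp sphere_subset_Zp Zp_carrier by (force simp: sphere_iff QM.commute)
  then show ?thesis using Z.cell_in_borel openin_in_borel_sigma_of[OF Z.openin_mball] by auto
qed

lemma sphere_haar_equidistributed: "S.equidistributed l (sphere_haar p l)"
proof -
  let ?S = "padic_sphere1 p l" and ?\<mu> = "sphere_haar p l"
  interpret H: prob_space "Zp_haar p" using Zp_haar_equidistributed by (simp add: Z.equidistributed_def)
  have sets_haar: "sets (Zp_haar p) = sets (borel_sigma_of Z.mtopology)"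
    using Zp_haar_equidistributed by (simp add: Z.equidistributed_def)
  have S: "?S \<in> sets (Zp_haar p)" using sphere_borel sets_haar by simp
  have Sspace: "?S \<inter> space (Zp_haar p) = ?S" using sets.sets_into_space[OF S] by blast
  let ?c = "measure (Zp_haar p) ?S"
  let ?x = "nat_padic (1 + p ^ l)"
  have x: "?x \<in> ?S" by (rule sphere_nonempty)
  have "Z.mcball ?x (1 / real p ^ Suc l) \<subseteq> ?S"
    using sphere_cell[OF x, of 0] S.mcball_subset_mspace by (metis add_0)
  then have "measure (Zp_haar p) (Z.mcball ?x (1 / real p ^ Suc l)) \<le> ?c" using S by (rule H.finite_measure_mono)
  moreover have "measure (Zp_haar p) (Z.mcball ?x (1 / real p ^ Suc l)) > 0"
    by (rule Z.equidistributed_cell_pos[OF Zp_haar_equidistributed]) simp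
  ultimately have c: "?c > 0" by linarith
  have em: "emeasure ?\<mu> B = ennreal (measure (Zp_haar p) B / ?c)" if "B \<subseteq> ?S" for B
  proof -
    have "emeasure ?\<mu> B = 1 / ennreal ?c * ennreal (measure (Zp_haar p) B)"
      using that S Sspace by (simp add: sphere_haar_def emeasure_restrict_space H.emeasure_eq_measure)
    also have "\<dots> = ennreal (1 / ?c) * ennreal (measure (Zp_haar p) B)"
      using divide_ennreal[of 1 ?c] c by simp
    finally show ?thesis using c by (simp flip: ennreal_mult)
  qed
  have space: "space ?\<mu> = ?S"
    using Sspace by (simp add: sphere_haar_def space_scale_measure space_restrict_space)
  have "prob_space ?\<mu>"
  proof
    show "emeasure ?\<mu> (space ?\<mu>) = 1" using em[of ?S] c by (simp add: space)
  qed
  moreover have "sets ?\<mu> = sets (borel_sigma_of (S.mtopology l))"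
  proof -
    have "sets (borel_sigma_of (subtopology Z.mtopology ?S)) = sets (restrict_space (borel_sigma_of Z.mtopology) ?S)"
      by (rule sets_borel_sigma_of_subtopology[OF sphere_borel])
    also have "\<dots> = sets ?\<mu>" by (simp add: sphere_haar_def sets_restrict_space sets_haar)
    finally show ?thesis using sphere_subset_Zp[of l]
      by (simp add: mtopology_sphere mtopology_Zp subtopology_subtopology Int_absorb1)
  qed
  moreover have "measure ?\<mu> (S.mcball l x (1 / real p ^ (k + Suc l))) =
      measure ?\<mu> (S.mcball l y (1 / real p ^ (k + Suc l)))" if xy: "x \<in> ?S" "y \<in> ?S" for x y k
  proof -
    have "measure (Zp_haar p) (S.mcball l x (1 / real p ^ (k + Suc l))) =
        measure (Zp_haar p) (S.mcball l y (1 / real p ^ (k + Suc l)))"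
      unfolding sphere_cell[OF xy(1)] sphere_cell[OF xy(2)] using Zp_haar_equidistributed xy sphere_subset_Zp unfolding Z.equidistributed_def by blast
    then have "emeasure ?\<mu> (S.mcball l x (1 / real p ^ (k + Suc l))) =
        emeasure ?\<mu> (S.mcball l y (1 / real p ^ (k + Suc l)))"
      by (simp only: em[OF S.mcball_subset_mspace])
    then show ?thesis by (simp only: measure_def)
  qed
  ultimately show ?thesis unfolding S.equidistributed_def by blast
qed

end

theorem theorem4p1:
  fixes p l n :: nat
  assumes "prime p" and "l \<ge> 1" and "gcd n p = 1"
  defines "S \<equiv> subtopology (padic_topology p) (padic_sphere1 p l)"
    and "\<psi> \<equiv> (\<lambda>x. x [^]\<^bsub>Qp p\<^esub> n)"
  shows "(minimal_map S \<psi> \<longleftrightarrow> uniquely_ergodic S \<psi>) \<and>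
    (uniquely_ergodic S \<psi> \<longrightarrow> (\<forall>\<mu>. invariant_borel_prob S \<psi> \<mu> \<longleftrightarrow> \<mu> = sphere_haar p l))"
proof -
  interpret padic p by unfold_locales (rule assms(1))
  have "\<not> p dvd n" using assms(1,3) by (metis gcd_nat.absorb2 not_prime_1)
  then have iso: "S.isometry l \<psi>" unfolding \<psi>_def using assms(2) by (rule power_isometry)
  have "S = S.mtopology l" by (simp add: S_def mtopology_sphere)
  then show ?thesis
    using S.isometry_minimal_iff_uniquely_ergodic[OF iso sphere_haar_equidistributed] by simp
qed

end
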